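(* There is an algorithm which, given a connected graph $G$ on $n$ vertices, an integer $k\in\mathbb{N}$, and a vertex cover $X\subseteq V(G)$ of $G$, decides whether $G$ is strongly conflict-free vertex-connection $k$-colorable in time $t(|X|)\cdot O(n^5)$, where $t(|X|)=|X|^{|X|+(|X|+1)\cdot 2^{|X|}}$. In particular, the problem of deciding whether $\mathrm{svcfc}(G)\le k$ (with input $G$, $k$) is fixed-parameter tractable when parameterized by the size of a given vertex cover.
   Context: All graphs are finite, simple, undirected. A vertex cover of $G$ is a set $X\subseteq V(G)$ such that $G-X$ is edgeless. Given a vertex coloring $f:V(G)\to[k]=\{1,\dots,k\}$, a path is conflict-free if some color $c\in[k]$ occurs on exactly one vertex of the path. A connected graph $G$ is strongly conflict-free vertex-connection $k$-colorable if there is $f:V(G)\to[k]$ such that any two distinct vertices $x,y$ are joined by a shortest $x,y$-path that is conflict-free under $f$. $\mathrm{svcfc}(G)$ is the smallest such $k$. A parameterized problem is fixed-parameter tractable if it can be decided in time $g(p)\cdot |x|^{c}$ for a computable $g$, constant $c$, input $x$ and parameter $p$.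
   Formalization: The factor t(|X|) is read as max(1, t(|X|)): for |X| = 0 (only the one-vertex graph with empty cover) t(0) = 0, and no algorithm runs in zero time; for |X| ≥ 1 the bound is as stated. *)

theory Defs
  imports
    "Graph_Theory.Digraph_Component"
    "Graph_Theory.Pair_Digraph"
    "Graph_Theory.Vertex_Walk"
    "HOL-Library.Log_Nat"
begin

section \<open>Strong conflict-free vertex-connection colorings\<close>

text \<open>
  Finite simple undirected graphs are the structures satisfying \<^const>\<open>pair_graph\<close>: finite
  loop-free digraphs whose set of arcs is a symmetric set of ordered pairs.
\<close>

definition vertex_cover :: "'a pair_pre_digraph \<Rightarrow> 'a set \<Rightarrow> bool" where
  "vertex_cover G X \<longleftrightarrow>
     X \<subseteq> pverts G \<and> arcs (with_proj G \<restriction> (pverts G - X)) = {}"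

definition shortest_path :: "'a pair_pre_digraph \<Rightarrow> 'a \<Rightarrow> 'a \<Rightarrow> 'a list \<Rightarrow> bool" where
  "shortest_path G x y p \<longleftrightarrow>
     vpath p (with_proj G) \<and> hd p = x \<and> last p = y \<and>
     (\<forall>q. vpath q (with_proj G) \<and> hd q = x \<and> last q = y \<longrightarrow> vwalk_length p \<le> vwalk_length q)"

definition conflict_free :: "nat \<Rightarrow> ('a \<Rightarrow> nat) \<Rightarrow> 'a list \<Rightarrow> bool" where
  "conflict_free k f p \<longleftrightarrow> (\<exists>c\<in>{1..k}. \<exists>!v. v \<in> set p \<and> f v = c)"

definition svcf_colorable :: "'a pair_pre_digraph \<Rightarrow> nat \<Rightarrow> bool" where
  "svcf_colorable G k \<longleftrightarrow>
     (\<exists>f. f ` pverts G \<subseteq> {1..k} \<and>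
        (\<forall>x\<in>pverts G. \<forall>y\<in>pverts G. x \<noteq> y \<longrightarrow>
           (\<exists>p. shortest_path G x y p \<and> conflict_free k f p)))"

text \<open>
  For a finite connected graph the minimum is attained: an injective coloring is always
  admissible.
\<close>

definition svcfc :: "'a pair_pre_digraph \<Rightarrow> nat" where
  "svcfc G = (LEAST k. svcf_colorable G k)"


section \<open>Random access machines\<close>

text \<open>
  The machine model is a structured random access machine: finitely many named registers, a
  memory indexed by natural numbers with indirect addressing, and addition, truncated
  subtraction and comparison as the only operations on numbers.  Every operation, memory access
  and test costs one unit of time.  There is deliberately no multiplication: with addition
  alone the bit length of numbers grows by a constant per step, so unit-cost time is polynomially
  related to Turing machine time.
\<close>

datatype aexp =
    Const nat
  | Reg string
  | Mem aexp
  | Add aexp aexp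
  | Sub aexp aexp

datatype bexp =
    Less aexp aexp
  | Neg bexp
  | Conj bexp bexp

datatype com =
    Skip
  | Assign string aexp
  | Store aexp aexp
  | Seq com com
  | Cond bexp com com
  | While bexp com

record ram =
  reg :: "string \<Rightarrow> nat"
  mem :: "nat \<Rightarrow> nat"

fun aval :: "aexp \<Rightarrow> ram \<Rightarrow> nat" where
  "aval (Const n) s = n"
| "aval (Reg x) s = reg s x"
| "aval (Mem a) s = mem s (aval a s)"
| "aval (Add a b) s = aval a s + aval b s"
| "aval (Sub a b) s = aval a s - aval b s"

fun bval :: "bexp \<Rightarrow> ram \<Rightarrow> bool" where
  "bval (Less a b) s \<longleftrightarrow> aval a s < aval b s"
| "bval (Neg b) s \<longleftrightarrow> \<not> bval b s"
| "bval (Conj b c) s \<longleftrightarrow> bval b s \<and> bval c s"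

fun acost :: "aexp \<Rightarrow> nat" where
  "acost (Const n) = 1"
| "acost (Reg x) = 1"
| "acost (Mem a) = 1 + acost a"
| "acost (Add a b) = 1 + acost a + acost b"
| "acost (Sub a b) = 1 + acost a + acost b"

fun bcost :: "bexp \<Rightarrow> nat" where
  "bcost (Less a b) = 1 + acost a + acost b"
| "bcost (Neg b) = 1 + bcost b"
| "bcost (Conj b c) = 1 + bcost b + bcost c"

text \<open>
  \<open>exec P s t s'\<close>: started in state \<open>s\<close>, program \<open>P\<close> halts after exactly \<open>t\<close> time units in
  state \<open>s'\<close>.
\<close>

inductive exec :: "com \<Rightarrow> ram \<Rightarrow> nat \<Rightarrow> ram \<Rightarrow> bool" where
  Skip: "exec Skip s 1 s"
| Assign: "exec (Assign x a) s (1 + acost a) (s\<lparr>reg := (reg s)(x := aval a s)\<rparr>)"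
| Store: "exec (Store a b) s (1 + acost a + acost b)
            (s\<lparr>mem := (mem s)(aval a s := aval b s)\<rparr>)"
| Seq: "exec P s t s' \<Longrightarrow> exec Q s' u s'' \<Longrightarrow> exec (Seq P Q) s (t + u) s''"
| CondTrue: "bval b s \<Longrightarrow> exec P s t s' \<Longrightarrow> exec (Cond b P Q) s (1 + bcost b + t) s'"
| CondFalse: "\<not> bval b s \<Longrightarrow> exec Q s t s' \<Longrightarrow> exec (Cond b P Q) s (1 + bcost b + t) s'"
| WhileFalse: "\<not> bval b s \<Longrightarrow> exec (While b P) s (1 + bcost b) s"
| WhileTrue: "bval b s \<Longrightarrow> exec P s t s' \<Longrightarrow> exec (While b P) s' u s'' \<Longrightarrow>
     exec (While b P) s (1 + bcost b + t + u) s''"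

inductive_cases exec_SkipE: "exec Skip s t s'"
  and exec_AssignE: "exec (Assign x a) s t s'"
  and exec_StoreE: "exec (Store a b) s t s'"
  and exec_SeqE: "exec (Seq P Q) s t s'"
  and exec_CondE: "exec (Cond b P Q) s t s'"
  and exec_WhileE: "exec (While b P) s t s'"

lemma exec_deterministic:
  "exec P s t s' \<Longrightarrow> exec P s u s'' \<Longrightarrow> u = t \<and> s'' = s'"
proof (induction arbitrary: u s'' rule: exec.induct)
  case (Skip s)
  then show ?case by (auto elim: exec_SkipE)
next
  case (Assign x a s)
  then show ?case by (auto elim: exec_AssignE)
next
  case (Store a b s)
  then show ?case by (auto elim: exec_StoreE)
next
  case (Seq P s t s1 Q u1 s2)
  from \<open>exec (Seq P Q) s u s''\<close> obtain t' u' r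
    where "exec P s t' r" "exec Q r u' s''" "u = t' + u'"
    by (rule exec_SeqE)
  with Seq.IH show ?case by metis
next
  case (CondTrue b s P t s1 Q)
  from \<open>exec (Cond b P Q) s u s''\<close> \<open>bval b s\<close> obtain t'
    where "exec P s t' s''" "u = 1 + bcost b + t'"
    by (auto elim: exec_CondE)
  with CondTrue.IH show ?case by metis
next
  case (CondFalse b s Q t s1 P)
  from \<open>exec (Cond b P Q) s u s''\<close> \<open>\<not> bval b s\<close> obtain t'
    where "exec Q s t' s''" "u = 1 + bcost b + t'"
    by (auto elim: exec_CondE)
  with CondFalse.IH show ?case by metis
next
  case (WhileFalse b s P)
  then show ?case by (auto elim: exec_WhileE)
next
  case (WhileTrue b s P t s1 u1 s2)
  from \<open>exec (While b P) s u s''\<close> \<open>bval b s\<close> obtain t' u' r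
    where "exec P s t' r" "exec (While b P) r u' s''" "u = 1 + bcost b + t' + u'"
    by (auto elim: exec_WhileE)
  with WhileTrue.IH show ?case by metis
qed

text \<open>
  An input, a list of natural numbers, is placed in the memory cells from address 0 on; all other
  cells and all registers start with 0.  The output is the final value of register \<open>out\<close>.
\<close>

definition init :: "nat list \<Rightarrow> ram" where
  "init xs = \<lparr>reg = (\<lambda>_. 0), mem = (\<lambda>i. if i < length xs then xs ! i else 0)\<rparr>"

definition computes_within :: "com \<Rightarrow> nat list \<Rightarrow> nat \<Rightarrow> nat \<Rightarrow> bool" where
  "computes_within P xs v T \<longleftrightarrow> (\<exists>t s. exec P (init xs) t s \<and> t \<le> T \<and> reg s ''out'' = v)"

definition decides_within :: "com \<Rightarrow> nat list \<Rightarrow> bool \<Rightarrow> nat \<Rightarrow> bool" where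
  "decides_within P xs b T \<longleftrightarrow> computes_within P xs (of_bool b) T"

definition computable :: "(nat \<Rightarrow> nat) \<Rightarrow> bool" where
  "computable g \<longleftrightarrow> (\<exists>P. \<forall>m. \<exists>T. computes_within P [m] (g m) T)"


section \<open>Fixed-parameter tractability\<close>

text \<open>
  Length of an input in bits, with one extra bit per number as a delimiter.
\<close>

definition input_size :: "nat list \<Rightarrow> nat" where
  "input_size xs = (\<Sum>m\<leftarrow>xs. floorlog 2 m + 1)"

text \<open>
  A parameterized problem is given by its set \<open>I\<close> of instances, their encoding \<open>enc\<close>, the
  parameter \<open>\<kappa>\<close> and the yes-instances \<open>yes\<close>.
\<close>

definition fpt :: "'i set \<Rightarrow> ('i \<Rightarrow> nat list) \<Rightarrow> ('i \<Rightarrow> nat) \<Rightarrow> ('i \<Rightarrow> bool) \<Rightarrow> bool" where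
  "fpt I enc \<kappa> yes \<longleftrightarrow>
     (\<exists>P g c. computable g \<and>
        (\<forall>x\<in>I. decides_within P (enc x) (yes x) (g (\<kappa> x) * input_size (enc x) ^ c)))"


section \<open>The problem\<close>

text \<open>
  Inputs are graphs with the vertices numbered 0, ..., n - 1; every finite graph is isomorphic
  to such a graph.
\<close>

definition svcfc_instances :: "(nat pair_pre_digraph \<times> nat \<times> nat set) set" where
  "svcfc_instances = {(G, k, X).
     pair_graph G \<and> pverts G = {..<card (pverts G)} \<and>
     Digraph_Component.connected (with_proj G) \<and> vertex_cover G X}"

text \<open>
  The number n of vertices, the number k, the n * n adjacency matrix row by row, and the
  characteristic vector of X.
\<close>

fun encode :: "nat pair_pre_digraph \<times> nat \<times> nat set \<Rightarrow> nat list" where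
  "encode (G, k, X) =
     (let n = card (pverts G) in
      [n, k] @ [of_bool ((i, j) \<in> parcs G). i \<leftarrow> [0..<n], j \<leftarrow> [0..<n]]
             @ [of_bool (i \<in> X). i \<leftarrow> [0..<n]])"

text \<open>
  \<open>t_bound 0 = 0\<close>, and the empty set is a vertex cover of the one-vertex graph; no program runs in
  0 steps, so time bounds have to use \<open>max 1 (t_bound p)\<close>.  This differs from \<open>t_bound p\<close> only at
  \<open>p = 0\<close>.
\<close>

definition t_bound :: "nat \<Rightarrow> nat" where
  "t_bound p = p ^ (p + (p + 1) * 2 ^ p)"

end

theory Submission
  imports Defs
begin

text \<open>
  Two vertices with the same neighbourhood are interchangeable, so whether a coloring is admissible
  depends, for every class of twins, only on the set of its colors and on which of them occur at
  least twice.  If a class has more than \<open>k + 1\<close> vertices, some color is repeated, and the class can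
  be recolored such that all vertices from the \<open>(k + 1)\<close>-st on share a color.  Hence only the first
  \<open>k + 1\<close> vertices of each class have to be colored freely.  A vertex cover \<open>X\<close> leaves at most
  \<open>2 ^ card X\<close> classes outside \<open>X\<close>, and \<open>card X + 1\<close> colors always suffice, because every path with
  an edge meets \<open>X\<close>.  So at most \<open>t_bound (card X)\<close> colorings have to be tried.  For each of them a
  breadth-first search from every vertex, once for each color, determines whether there are shortest
  paths with exactly one vertex of that color; this takes time \<open>O (n ^ 5)\<close>.
\<close>

subsection \<open>Timed correctness of random access machine programs\<close>

text \<open>The recoloring rests on mapping walks, not on automorphisms: replacing every vertex of a
  walk by some twin gives a walk of the same length, even if the replacement is not injective. A
  conflict-free shortest path between distinct twins of \<open>x\<close> and \<open>y\<close> can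
  therefore be moved to \<open>x\<close> and \<open>y\<close> with its sequence of colors intact.
  The word "distinct" is why repeated colors must be remembered: two twins of equal new color need
  two old twins of that color, so a recoloring may repeat only a color that was repeated before. A
  shortest path to \<open>y\<close> extends a shortest path to a neighbor one layer closer, and a
  color occurring exactly once arises from a prefix with one or with no occurrence. So two bits per
  vertex replace the possibly exponentially many shortest paths. The bound \<open>t_bound\<close>
  needs \<open>k \<le> card X\<close>; larger \<open>k\<close> are answered at once. This also gives
  \<open>k \<le> n\<close>, so that sources, colors, layers, vertices and neighbors contribute one
  factor \<open>n\<close> each. The machine cannot multiply, hence matrix rows are addressed through
  a precomputed table.\<close>

definition runs :: "com \<Rightarrow> ram \<Rightarrow> nat \<Rightarrow> (ram \<Rightarrow> bool) \<Rightarrow> bool" where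
  "runs P s T Q \<longleftrightarrow> (\<exists>t s'. exec P s t s' \<and> t \<le> T \<and> Q s')"

primrec writes :: "com \<Rightarrow> string set" where
  "writes Skip = {}"
| "writes (Assign x a) = {x}"
| "writes (Store a b) = {}"
| "writes (Seq P R) = writes P \<union> writes R"
| "writes (Cond b P R) = writes P \<union> writes R"
| "writes (While b P) = writes P"

primrec store_free :: "com \<Rightarrow> bool" where
  "store_free Skip \<longleftrightarrow> True"
| "store_free (Assign x a) \<longleftrightarrow> True"
| "store_free (Store a b) \<longleftrightarrow> False"
| "store_free (Seq P R) \<longleftrightarrow> store_free P \<and> store_free R"
| "store_free (Cond b P R) \<longleftrightarrow> store_free P \<and> store_free R"
| "store_free (While b P) \<longleftrightarrow> store_free P"

text \<open>A purely syntactic frame condition, so that loop invariants need not list the registers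
  and memory that a body leaves alone.\<close>

definition framed :: "com \<Rightarrow> ram \<Rightarrow> ram \<Rightarrow> bool" where
  "framed P s s' \<longleftrightarrow> (\<forall>x. x \<notin> writes P \<longrightarrow> reg s' x = reg s x) \<and> (store_free P \<longrightarrow> mem s' = mem s)"

lemma exec_framed: "exec P s t s' \<Longrightarrow> framed P s s'"
  unfolding framed_def by (induction rule: exec.induct) auto

lemma framed_reg: "framed P s s' \<Longrightarrow> x \<notin> writes P \<Longrightarrow> reg s' x = reg s x"
  and framed_mem: "framed P s s' \<Longrightarrow> store_free P \<Longrightarrow> mem s' = mem s"
  by (auto simp: framed_def)

text \<open>The rule of consequence; the weaker postcondition may also be derived from the frame
  condition.\<close>

lemma runs_mono:
  assumes "runs P s T Q" "T \<le> T'" "\<And>s'. framed P s s' \<Longrightarrow> Q s' \<Longrightarrow> Q' s'"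
  shows "runs P s T' Q'"
  using assms exec_framed unfolding runs_def by (meson le_trans)

lemma runs_time: "runs P s T Q \<Longrightarrow> T \<le> T' \<Longrightarrow> runs P s T' Q"
  by (rule runs_mono)

lemma runs_Skip: "Q s \<Longrightarrow> runs Skip s 1 Q"
  unfolding runs_def by (blast intro: exec.Skip)

lemma runs_Assign:
  "Q (s\<lparr>reg := (reg s)(x := aval a s)\<rparr>) \<Longrightarrow> runs (Assign x a) s (1 + acost a) Q"
  unfolding runs_def by (blast intro: exec.Assign)

lemma runs_Store:
  "Q (s\<lparr>mem := (mem s)(aval a s := aval b s)\<rparr>) \<Longrightarrow> runs (Store a b) s (1 + acost a + acost b) Q"
  unfolding runs_def by (blast intro: exec.Store)

lemma runs_Seq:
  assumes "runs P s T1 (\<lambda>s'. runs R s' T2 Q)"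
  shows "runs (Seq P R) s (T1 + T2) Q"
  using assms unfolding runs_def by (meson add_mono exec.Seq)

lemma runs_Seq_use:
  assumes "runs P s T1 Q1" "\<And>s'. framed P s s' \<Longrightarrow> Q1 s' \<Longrightarrow> runs R s' T2 Q"
  shows "runs (Seq P R) s (T1 + T2) Q"
  by (rule runs_Seq, rule runs_mono[OF assms(1)]) (use assms(2) in auto)

lemma runs_Cond:
  assumes "bval b s \<Longrightarrow> runs P s T1 Q" "\<not> bval b s \<Longrightarrow> runs R s T2 Q"
  shows "runs (Cond b P R) s (1 + bcost b + max T1 T2) Q"
proof (cases "bval b s")
  case True
  then obtain t s' where "exec P s t s'" "t \<le> T1" "Q s'"
    using assms(1) unfolding runs_def by blast
  with True show ?thesis
    unfolding runs_def using exec.CondTrue[of b s P t s' R]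
    by (intro exI[of _ "1 + bcost b + t"] exI[of _ s']) simp
next
  case False
  then obtain t s' where "exec R s t s'" "t \<le> T2" "Q s'"
    using assms(2) unfolding runs_def by blast
  with False show ?thesis
    unfolding runs_def using exec.CondFalse[of b s R t s' P]
    by (intro exI[of _ "1 + bcost b + t"] exI[of _ s']) simp
qed

lemma runs_Seq_le:
  assumes "runs P s T1 Q1" "\<And>s'. framed P s s' \<Longrightarrow> Q1 s' \<Longrightarrow> runs R s' T2 Q" "T1 + T2 \<le> T"
  shows "runs (Seq P R) s T Q"
  by (rule runs_time[OF runs_Seq_use[OF assms(1)]]) (use assms in auto)

lemma runs_Cond_le:
  assumes "bval b s \<Longrightarrow> runs P s T' Q" "\<not> bval b s \<Longrightarrow> runs R s T' Q" "1 + bcost b + T' \<le> T"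
  shows "runs (Cond b P R) s T Q"
  by (rule runs_time[OF runs_Cond[OF assms(1,2)]]) (use assms(3) in auto)

section \<open>Symbolic execution of loop-free code\<close>

primrec wp :: "com \<Rightarrow> (ram \<Rightarrow> bool) \<Rightarrow> ram \<Rightarrow> bool" where
  "wp Skip Q s \<longleftrightarrow> Q s"
| "wp (Assign x a) Q s \<longleftrightarrow> Q (s\<lparr>reg := (reg s)(x := aval a s)\<rparr>)"
| "wp (Store a b) Q s \<longleftrightarrow> Q (s\<lparr>mem := (mem s)(aval a s := aval b s)\<rparr>)"
| "wp (Seq P R) Q s \<longleftrightarrow> wp P (wp R Q) s"
| "wp (Cond b P R) Q s \<longleftrightarrow> (if bval b s then wp P Q s else wp R Q s)"
| "wp (While b P) Q s \<longleftrightarrow> False"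

text \<open>The junk value on loops is harmless, because \<^const>\<open>wp\<close> is false there.\<close>

primrec cost :: "com \<Rightarrow> nat" where
  "cost Skip = 1"
| "cost (Assign x a) = 1 + acost a"
| "cost (Store a b) = 1 + acost a + acost b"
| "cost (Seq P R) = cost P + cost R"
| "cost (Cond b P R) = 1 + bcost b + max (cost P) (cost R)"
| "cost (While b P) = 0"

lemma runs_wp_cost: "wp P Q s \<Longrightarrow> runs P s (cost P) Q"
proof (induction P arbitrary: Q s)
  case (Cond b P R)
  have "runs (Cond b P R) s (1 + bcost b + max (cost P) (cost R)) Q"
    by (rule runs_Cond) (use Cond in auto)
  then show ?case by simp
next
  case (Seq P R)
  then have "runs P s (cost P) (wp R Q)" by simp
  then have "runs (Seq P R) s (cost P + cost R) Q"
    by (rule runs_Seq_use) (rule Seq.IH)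
  then show ?case by simp
next
  case (Assign x a)
  then show ?case
    using runs_Assign[of Q s x a] by simp
next
  case (Store a b)
  then show ?case
    using runs_Store[of Q s a b] by simp
qed (use runs_Skip in auto)

lemma runs_wp: "wp P Q s \<Longrightarrow> cost P \<le> T \<Longrightarrow> runs P s T Q"
  by (rule runs_time[OF runs_wp_cost])

text \<open>The invariant is indexed by the number of completed rounds. \<open>M\<close> is only an
  upper bound on that number: the guard may fail earlier, but must fail once \<open>M\<close> rounds
  are done.\<close>

lemma runs_While:
  assumes init: "I 0 s"
    and step: "\<And>m s'. m < M \<Longrightarrow> I m s' \<Longrightarrow> framed P s s' \<Longrightarrow> bval b s' \<Longrightarrow> runs P s' B (I (Suc m))"
    and stop: "\<And>s'. I M s' \<Longrightarrow> \<not> bval b s'"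
  shows "runs (While b P) s (M * (1 + bcost b + B) + 1 + bcost b)
           (\<lambda>s'. \<not> bval b s' \<and> (\<exists>m\<le>M. I m s'))"
proof -
  \<comment> \<open>Induction on the number \<open>d\<close> of rounds that are still
    allowed.\<close>
  have "\<exists>t s''. exec (While b P) s' t s'' \<and> t \<le> d * (1 + bcost b + B) + 1 + bcost b \<and>
          \<not> bval b s'' \<and> (\<exists>m\<le>M. I m s'')"
    if "I (M - d) s'" "d \<le> M" "framed P s s'" for d s'
    using that
  proof (induction d arbitrary: s')
    case 0
    then show ?case
      using stop[of s'] exec.WhileFalse[of b s' P]
      by (intro exI[of _ "1 + bcost b"] exI[of _ s']) auto
  next
    case (Suc d)
    show ?case
    proof (cases "bval b s'")
      case False
      moreover from Suc.prems(1) have "\<exists>m\<le>M. I m s'"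
        by (meson diff_le_self)
      ultimately show ?thesis using exec.WhileFalse[of b s' P]
        by (intro exI[of _ "1 + bcost b"] exI[of _ s']) auto
    next
      case True
      have "runs P s' B (I (Suc (M - Suc d)))"
        using Suc.prems True by (intro step) auto
      moreover have "Suc (M - Suc d) = M - d"
        using Suc.prems by simp
      ultimately obtain t1 s1 where t1: "exec P s' t1 s1" "t1 \<le> B" "I (M - d) s1"
        unfolding runs_def by auto
      have "framed P s s1"
        using exec_framed[OF t1(1)] Suc.prems(3) by (auto simp: framed_def)
      from Suc.IH[OF t1(3) _ this] Suc.prems obtain t2 s2 where
        t2: "exec (While b P) s1 t2 s2" "t2 \<le> d * (1 + bcost b + B) + 1 + bcost b"
          "\<not> bval b s2" "\<exists>m\<le>M. I m s2"
        by auto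
      show ?thesis
        using exec.WhileTrue[OF True t1(1) t2(1)] t1(2) t2(2-4)
        by (intro exI[of _ "1 + bcost b + t1 + t2"] exI[of _ s2]) auto
    qed
  qed
  from this[of M s] init show ?thesis
    unfolding runs_def by (simp add: framed_def)
qed

section \<open>Counting loops\<close>

definition For :: "string \<Rightarrow> string \<Rightarrow> com \<Rightarrow> com" where
  "For i N P = Seq (Assign i (Const 0))
     (While (Less (Reg i) (Reg N)) (Seq P (Assign i (Add (Reg i) (Const 1)))))"

lemma writes_For [simp]: "writes (For i N P) = insert i (writes P)"
  and store_free_For [simp]: "store_free (For i N P) = store_free P"
  by (auto simp: For_def)

text \<open>Per round, 4 units go to the guard and 4 to the increment; the final 6 are the
  initialization and the last, failing test. The body has to establish the invariant for the state
  after the increment.\<close>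

lemma runs_For:
  assumes "i \<notin> writes P" "N \<notin> writes P" "i \<noteq> N" "reg s N = m"
    and init: "I 0 (s\<lparr>reg := (reg s)(i := 0)\<rparr>)"
    and step: "\<And>j s'. j < m \<Longrightarrow> I j s' \<Longrightarrow> reg s' i = j \<Longrightarrow> framed (For i N P) s s' \<Longrightarrow>
      runs P s' B (\<lambda>s''. I (Suc j) (s''\<lparr>reg := (reg s'')(i := Suc j)\<rparr>))"
  shows "runs (For i N P) s (m * (B + 8) + 6) (\<lambda>s'. I m s' \<and> reg s' i = m)"
proof -
  let ?s = "s\<lparr>reg := (reg s)(i := 0)\<rparr>"
  let ?I = "\<lambda>j s'. I j s' \<and> reg s' i = j \<and> j \<le> m \<and> reg s' N = m"
  let ?b = "Less (Reg i) (Reg N)" and ?P = "Seq P (Assign i (Add (Reg i) (Const 1)))"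
  have "runs (While ?b ?P) ?s (m * (1 + bcost ?b + (B + 4)) + 1 + bcost ?b)
          (\<lambda>s'. \<not> bval ?b s' \<and> (\<exists>j\<le>m. ?I j s'))"
  proof (rule runs_While)
    show "?I 0 ?s"
      using assms by simp
    fix j s' assume j: "j < m" "?I j s'" "framed ?P ?s s'" "bval ?b s'"
    have "framed (For i N P) s s'"
      using j(3) assms(3) by (auto simp: framed_def)
    with j have "runs P s' B (\<lambda>s''. I (Suc j) (s''\<lparr>reg := (reg s'')(i := Suc j)\<rparr>))"
      by (intro step) auto
    then have "runs ?P s' (B + (1 + acost (Add (Reg i) (Const 1)))) (?I (Suc j))"
      by (rule runs_Seq_use, intro runs_Assign) (use assms j in \<open>simp add: framed_reg\<close>)
    then show "runs ?P s' (B + 4) (?I (Suc j))"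
      by (rule runs_time) simp
  qed simp
  then have "runs (For i N P) s ((1 + acost (Const 0)) + (m * (1 + bcost ?b + (B + 4)) + 1 + bcost ?b))
       (\<lambda>s'. \<not> bval ?b s' \<and> (\<exists>j\<le>m. ?I j s'))"
    unfolding For_def by (intro runs_Seq runs_Assign) simp
  then show ?thesis
    by (rule runs_mono) auto
qed

text \<open>As \<open>n\<close> is positive, the additive 6 is paid as \<open>n * 6\<close>, which
  makes the overhead 8 + 6 = 14 per round.\<close>

lemma runs_For_le:
  assumes "i \<notin> writes P" "N \<notin> writes P" "i \<noteq> N" "reg s N \<le> n" "0 < n"
    and init: "I 0 (s\<lparr>reg := (reg s)(i := 0)\<rparr>)"
    and step: "\<And>j s'. j < reg s N \<Longrightarrow> I j s' \<Longrightarrow> reg s' i = j \<Longrightarrow> framed (For i N P) s s' \<Longrightarrow>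
      runs P s' B (\<lambda>s''. I (Suc j) (s''\<lparr>reg := (reg s'')(i := Suc j)\<rparr>))"
    and fin: "\<And>s'. I (reg s N) s' \<Longrightarrow> framed (For i N P) s s' \<Longrightarrow> Q s'"
    and time: "n * (B + 14) \<le> T"
  shows "runs (For i N P) s T Q"
proof (rule runs_mono[OF runs_For[OF assms(1-3) refl]])
  show "I 0 (s\<lparr>reg := (reg s)(i := 0)\<rparr>)"
    by (rule init)
  have "reg s N * (B + 8) + 6 \<le> n * (B + 8) + n * 6"
    using assms(4,5) by (intro add_mono mult_right_mono) auto
  also have "\<dots> = n * (B + 14)"
    by (simp add: algebra_simps)
  finally show "reg s N * (B + 8) + 6 \<le> T"
    using time by simp
qed (use step fin in auto)

text \<open>Additive constants are absorbed because \<open>n ^ j\<close> is at least 1; every level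
  of nesting raises the exponent by one.\<close>

lemma loop_time:
  fixes n :: nat
  assumes "0 < n" "B \<le> a * n ^ j + b" "a + b + 14 \<le> c"
  shows "n * (B + 14) \<le> c * n ^ Suc j"
proof -
  have 1: "1 \<le> n ^ j"
    using assms(1) by simp
  have "B + 14 \<le> a * n ^ j + (b + 14) * 1"
    using assms(2) by simp
  also have "\<dots> \<le> a * n ^ j + (b + 14) * n ^ j"
    using 1 by (intro add_mono mult_left_mono) auto
  also have "\<dots> = (a + b + 14) * n ^ j"
    by (simp add: algebra_simps)
  also have "\<dots> \<le> c * n ^ j"
    using assms(3) by (rule mult_right_mono) simp
  finally have "n * (B + 14) \<le> n * (c * n ^ j)"
    by (rule mult_left_mono) simp
  then show ?thesis
    by (simp add: algebra_simps)
qed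

subsection \<open>Breadth-first search counting a color\<close>

text \<open>Symmetry is not assumed: the program is specified for an arbitrary Boolean matrix, and
  graph properties enter only when its answer is interpreted.\<close>

locale adjacency =
  fixes n :: nat and A :: "nat \<Rightarrow> nat \<Rightarrow> bool"
  assumes n_pos: "0 < n"
begin

text \<open>
  \<open>reached x l y\<close>: the distance from \<open>x\<close> to \<open>y\<close> is at most \<open>l\<close>; in that case \<open>none f c x l y\<close> and
  \<open>one f c x l y\<close> tell whether some shortest path from \<open>x\<close> to \<open>y\<close> has no vertex, respectively
  exactly one vertex, of color \<open>c\<close>.
\<close>

primrec reached :: "nat \<Rightarrow> nat \<Rightarrow> nat \<Rightarrow> bool" where
  "reached x 0 = (\<lambda>y. y = x)"
| "reached x (Suc l) = (\<lambda>y. reached x l y \<or> (\<exists>u<n. A y u \<and> reached x l u))"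

primrec none :: "(nat \<Rightarrow> nat) \<Rightarrow> nat \<Rightarrow> nat \<Rightarrow> nat \<Rightarrow> nat \<Rightarrow> bool" where
  "none f c x 0 = (\<lambda>y. y = x \<and> f x \<noteq> c)"
| "none f c x (Suc l) = (\<lambda>y. if reached x l y then none f c x l y
     else f y \<noteq> c \<and> (\<exists>u<n. A y u \<and> none f c x l u))"

primrec one :: "(nat \<Rightarrow> nat) \<Rightarrow> nat \<Rightarrow> nat \<Rightarrow> nat \<Rightarrow> nat \<Rightarrow> bool" where
  "one f c x 0 = (\<lambda>y. y = x \<and> f x = c)"
| "one f c x (Suc l) = (\<lambda>y. if reached x l y then one f c x l y
     else if f y = c then \<exists>u<n. A y u \<and> none f c x l u
     else \<exists>u<n. A y u \<and> one f c x l u)"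

definition good_source :: "nat \<Rightarrow> (nat \<Rightarrow> nat) \<Rightarrow> nat \<Rightarrow> bool" where
  "good_source k f x \<longleftrightarrow> (\<forall>y<n. y \<noteq> x \<longrightarrow> (\<exists>c<k. one f c x n y))"

definition twin :: "nat \<Rightarrow> nat \<Rightarrow> bool" where
  "twin u v \<longleftrightarrow> (\<forall>w<n. A u w \<longleftrightarrow> A v w)"

definition rank :: "nat \<Rightarrow> nat" where
  "rank v = card {u. u < v \<and> twin u v}"

text \<open>
  In a search for colorings with \<open>k\<close> colors only the first \<open>k + 1\<close> vertices of a class of twins
  are colored freely; the further ones copy the color of the last free vertex.
\<close>

definition copies :: "nat \<Rightarrow> nat \<Rightarrow> nat \<Rightarrow> bool" where
  "copies k v r \<longleftrightarrow> (if rank v \<le> k then r = v else r < v \<and> twin r v \<and> rank r = k)"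

text \<open>Radix 1 pins the digit of a vertex that is not free to 0, so that it contributes no
  factor to the number of colorings.\<close>

definition radix :: "nat \<Rightarrow> nat \<Rightarrow> nat" where
  "radix k v = (if rank v \<le> k then k else 1)"

lemma twin_refl: "twin v v"
  and twin_sym: "twin u v \<Longrightarrow> twin v u"
  and twin_trans: "twin u v \<Longrightarrow> twin v w \<Longrightarrow> twin u w"
  by (auto simp: twin_def)

lemma copies_le: "copies k v r \<Longrightarrow> r \<le> v"
  by (auto simp: copies_def split: if_splits)

end

subsection \<open>Shortest walks\<close>

text \<open>The search counts occurrences along a list, conflict-freeness counts vertices; on paths
  without repetition the two agree.\<close>

lemma count_list_map_distinct:
  assumes "distinct p"
  shows "count_list (map f p) c = card {v \<in> set p. f v = c}"
proof -
  have "count_list (map f p) c = length (filter (\<lambda>v. c = f v) p)"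
    by (simp add: count_list_eq_length_filter filter_map comp_def)
  also have "\<dots> = card (set (filter (\<lambda>v. c = f v) p))"
    using assms by (simp add: distinct_card del: set_filter)
  also have "set (filter (\<lambda>v. c = f v) p) = {v \<in> set p. f v = c}"
    by auto
  finally show ?thesis .
qed

locale finite_graph = adjacency +
  assumes sym: "A u v \<Longrightarrow> A v u" and dom: "A u v \<Longrightarrow> u < n"
begin

text \<open>Repeated vertices are allowed, which keeps walks closed under replacing vertices by
  twins. Minimality restores distinctness.\<close>

definition walk :: "nat \<Rightarrow> nat \<Rightarrow> nat list \<Rightarrow> bool" where
  "walk x y p \<longleftrightarrow> p \<noteq> [] \<and> set p \<subseteq> {..<n} \<and> successively A p \<and> hd p = x \<and> last p = y"

definition geodesic :: "nat \<Rightarrow> nat \<Rightarrow> nat list \<Rightarrow> bool" where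
  "geodesic x y p \<longleftrightarrow> walk x y p \<and> (\<forall>q. walk x y q \<longrightarrow> length p \<le> length q)"

lemma walk_snoc: "walk x y p \<Longrightarrow> A y z \<Longrightarrow> walk x z (p @ [z])"
  using dom sym by (auto simp: walk_def successively_append_iff)

lemma walk_butlast:
  assumes "walk x y p" "2 \<le> length p"
  obtains u p' where "p = p' @ [y]" "walk x u p'" "A u y"
proof -
  obtain p' where p: "p = p' @ [y]"
    using assms(1) unfolding walk_def by (metis append_butlast_last_id)
  then have "p' \<noteq> []"
    using assms(2) by auto
  then have "walk x (last p') p'" "A (last p') y"
    using assms(1) by (auto simp: p walk_def successively_append_iff)
  with p that show thesis by blast
qed

lemma geodesic_exists:
  assumes "walk x y p"
  obtains q where "geodesic x y q" "length q \<le> length p"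
proof -
  let ?q = "arg_min length (walk x y)"
  have "geodesic x y ?q"
    unfolding geodesic_def using arg_min_nat_lemma[of "walk x y" p length] assms by blast
  with assms that show thesis by (auto simp: geodesic_def)
qed

lemma geodesic_distinct:
  assumes "geodesic x y p"
  shows "distinct p"
proof (rule ccontr)
  assume "\<not> distinct p"
  then obtain xs v ys zs where p: "p = xs @ [v] @ ys @ [v] @ zs"
    using not_distinct_decomp by blast
  \<comment> \<open>Cutting out the closed detour at the repeated vertex \<open>v\<close> leaves a
    shorter walk.\<close>
  have "walk x y (xs @ [v] @ zs)"
    using assms unfolding geodesic_def walk_def p
    by (auto simp: successively_append_iff successively_Cons hd_append split: if_splits)
  moreover have "length (xs @ [v] @ zs) < length p"
    by (simp add: p)
  ultimately show False
    using assms unfolding geodesic_def by (metis not_less)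
qed

lemma geodesic_length:
  assumes "geodesic x y p"
  shows "length p \<le> n"
proof -
  have "length p = card (set p)"
    using geodesic_distinct[OF assms] by (simp add: distinct_card)
  also have "\<dots> \<le> card {..<n}"
    using assms by (intro card_mono) (auto simp: geodesic_def walk_def)
  finally show ?thesis by simp
qed

text \<open>Distance counts edges, \<open>length\<close> counts vertices, whence
  \<open>Suc l\<close>.\<close>

lemma reached_iff:
  assumes "x < n"
  shows "reached x l y \<longleftrightarrow> (\<exists>p. walk x y p \<and> length p \<le> Suc l)"
proof (induction l arbitrary: y)
  case 0
  show ?case
  proof
    assume "reached x 0 y"
    then show "\<exists>p. walk x y p \<and> length p \<le> Suc 0"
      using assms by (intro exI[of _ "[x]"]) (simp add: walk_def)
  next
    assume "\<exists>p. walk x y p \<and> length p \<le> Suc 0"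
    then obtain p where "walk x y p" "length p \<le> Suc 0" by blast
    then show "reached x 0 y"
      by (cases p) (auto simp: walk_def)
  qed
next
  case (Suc l)
  show ?case
  proof
    assume "reached x (Suc l) y"
    then consider "reached x l y" | u where "A y u" "reached x l u"
      by auto
    then show "\<exists>p. walk x y p \<and> length p \<le> Suc (Suc l)"
    proof cases
      case 1
      then show ?thesis using Suc by (meson le_SucI)
    next
      case 2
      then obtain p where "walk x u p" "length p \<le> Suc l"
        using Suc by blast
      then show ?thesis
        using walk_snoc[of x u p y] 2 sym by (intro exI[of _ "p @ [y]"]) simp
    qed
  next
    assume "\<exists>p. walk x y p \<and> length p \<le> Suc (Suc l)"
    then obtain p where p: "walk x y p" "length p \<le> Suc (Suc l)" by blast
    show "reached x (Suc l) y"
    proof (cases "length p \<le> Suc l")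
      case True
      then show ?thesis using p Suc by auto
    next
      case False
      then have "2 \<le> length p" by linarith
      with p obtain u p' where "p = p' @ [y]" "walk x u p'" "A u y"
        using walk_butlast by blast
      moreover from this have "A y u" "u < n" "length p' \<le> Suc l"
        using sym dom p(2) by auto
      ultimately show ?thesis using Suc by auto
    qed
  qed
qed

text \<open>If \<open>y\<close> is not reached within \<open>l\<close> edges, every walk to
  \<open>y\<close> has at least \<open>l + 2\<close> vertices. So extending a short enough geodesic
  of a neighbor is automatically minimal, and conversely a prefix of a geodesic is one. The
  predicate \<open>P\<close> is kept arbitrary to serve \<open>none\<close> and \<open>one\<close>
  alike.\<close>

lemma geodesic_Suc_iff:
  assumes x: "x < n" and nr: "\<not> reached x l y"
  shows "(\<exists>p. geodesic x y p \<and> length p \<le> Suc (Suc l) \<and> P p) \<longleftrightarrow>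
    (\<exists>u<n. A y u \<and> (\<exists>p. geodesic x u p \<and> length p \<le> Suc l \<and> P (p @ [y])))"
proof
  have long: "Suc (Suc l) \<le> length p" if "walk x y p" for p
    using nr that reached_iff[OF x] by (meson not_less_eq_eq)
  {
    assume "\<exists>p. geodesic x y p \<and> length p \<le> Suc (Suc l) \<and> P p"
    then obtain p where p: "geodesic x y p" "length p \<le> Suc (Suc l)" "P p" by blast
    then have w: "walk x y p" by (simp add: geodesic_def)
    from long[OF w] have "2 \<le> length p" by simp
    then obtain u p' where p': "p = p' @ [y]" "walk x u p'" "A u y"
      using walk_butlast[OF w] by blast
    have "length p' \<le> length r" if "walk x u r" for r
      using p(1) walk_snoc[OF that p'(3)] p'(1) unfolding geodesic_def by fastforce
    with p' have "geodesic x u p'"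
      by (simp add: geodesic_def)
    moreover have "A y u" "u < n"
      using p'(3) sym dom by blast+
    moreover have "length p' \<le> Suc l" "P (p' @ [y])"
      using p p' by auto
    ultimately show "\<exists>u<n. A y u \<and> (\<exists>p. geodesic x u p \<and> length p \<le> Suc l \<and> P (p @ [y]))"
      by blast
  }
  {
    assume "\<exists>u<n. A y u \<and> (\<exists>p. geodesic x u p \<and> length p \<le> Suc l \<and> P (p @ [y]))"
    then obtain u p where p: "A y u" "geodesic x u p" "length p \<le> Suc l" "P (p @ [y])" by blast
    then have "walk x y (p @ [y])"
      using walk_snoc sym unfolding geodesic_def by blast
    moreover have "length (p @ [y]) \<le> length r" if "walk x y r" for r
      using long[OF that] p(3) by simp
    ultimately have "geodesic x y (p @ [y])"
      unfolding geodesic_def by blast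
    with p show "\<exists>p. geodesic x y p \<and> length p \<le> Suc (Suc l) \<and> P p"
      by (intro exI[of _ "p @ [y]"]) simp
  }
qed

text \<open>All geodesics between two vertices have the same length, so a vertex reached earlier
  gains no new ones. This justifies copying its flags.\<close>

lemma geodesic_reached_iff:
  assumes x: "x < n" and r: "reached x l y"
  shows "(\<exists>p. geodesic x y p \<and> length p \<le> Suc (Suc l) \<and> P p) \<longleftrightarrow>
    (\<exists>p. geodesic x y p \<and> length p \<le> Suc l \<and> P p)"
proof -
  obtain r where "walk x y r" "length r \<le> Suc l"
    using r reached_iff[OF x] by blast
  then have "length p \<le> Suc l" if "geodesic x y p" for p
    using that unfolding geodesic_def by (meson le_trans)
  then show ?thesis by (meson le_SucI)
qed

lemma geodesic_singleton_iff:
  assumes "x < n"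
  shows "geodesic x y p \<and> length p \<le> Suc 0 \<longleftrightarrow> y = x \<and> p = [x]"
proof -
  have "length p \<le> Suc 0 \<and> p \<noteq> [] \<longleftrightarrow> (\<exists>v. p = [v])"
    by (cases p) auto
  then show ?thesis
    using assms unfolding geodesic_def walk_def by (auto simp: Suc_le_eq)
qed

lemma none_iff:
  assumes "x < n"
  shows "none f c x l y \<longleftrightarrow> (\<exists>p. geodesic x y p \<and> length p \<le> Suc l \<and> count_list (map f p) c = 0)"
proof (induction l arbitrary: y)
  case 0
  have "(\<exists>p. geodesic x y p \<and> length p \<le> Suc 0 \<and> count_list (map f p) c = 0) \<longleftrightarrow>
    (\<exists>p. (y = x \<and> p = [x]) \<and> count_list (map f p) c = 0)"
    using geodesic_singleton_iff[OF assms] by metis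
  then show ?case by auto
next
  case (Suc l)
  show ?case
  proof (cases "reached x l y")
    case True
    then show ?thesis
      using Suc geodesic_reached_iff[OF assms True] by simp
  next
    case False
    show ?thesis
      unfolding geodesic_Suc_iff[OF assms False] using False Suc by auto
  qed
qed

lemma one_iff:
  assumes "x < n"
  shows "one f c x l y \<longleftrightarrow> (\<exists>p. geodesic x y p \<and> length p \<le> Suc l \<and> count_list (map f p) c = 1)"
proof (induction l arbitrary: y)
  case 0
  have "(\<exists>p. geodesic x y p \<and> length p \<le> Suc 0 \<and> count_list (map f p) c = 1) \<longleftrightarrow>
    (\<exists>p. (y = x \<and> p = [x]) \<and> count_list (map f p) c = 1)"
    using geodesic_singleton_iff[OF assms] by metis
  then show ?case by auto
next
  case (Suc l)
  show ?case
  proof (cases "reached x l y")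
    case True
    then show ?thesis
      using Suc geodesic_reached_iff[OF assms True] by simp
  next
    case False
    show ?thesis
      unfolding geodesic_Suc_iff[OF assms False] using False Suc none_iff[OF assms] by auto
  qed
qed

text \<open>\<open>n\<close> layers suffice because a geodesic has at most \<open>n\<close>
  vertices.\<close>

lemma good_source_iff:
  assumes "x < n"
  shows "good_source k f x \<longleftrightarrow>
    (\<forall>y<n. y \<noteq> x \<longrightarrow> (\<exists>c<k. \<exists>p. geodesic x y p \<and> count_list (map f p) c = 1))"
proof -
  have "one f c x n y \<longleftrightarrow> (\<exists>p. geodesic x y p \<and> count_list (map f p) c = 1)" for c y
    using one_iff[OF assms] geodesic_length by (meson le_SucI)
  then show ?thesis by (simp add: good_source_def)
qed

lemma good_source_cong:
  assumes "x < n" "\<And>v. v < n \<Longrightarrow> f v = g v"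
  shows "good_source k f x \<longleftrightarrow> good_source k g x"
proof -
  have "map f p = map g p" if "geodesic x y p" for p y
    using that assms(2) by (auto simp: geodesic_def walk_def)
  then show ?thesis
    unfolding good_source_iff[OF assms(1)] by metis
qed

subsection \<open>Recoloring twins\<close>

text \<open>In an edge the two ends can be replaced one after the other, with symmetry in between;
  injectivity of \<open>h\<close> never enters.\<close>

lemma walk_map_twin:
  assumes "walk x y p" "\<And>v. v < n \<Longrightarrow> h v < n" "\<And>v. v < n \<Longrightarrow> twin v (h v)"
  shows "walk (h x) (h y) (map h p)"
proof -
  have "A (h u) (h v)" if "A u v" for u v
  proof -
    have uv: "u < n" "v < n" using that dom sym by blast+
    then have "A (h u) v" using that assms(3)[of u] by (simp add: twin_def)
    then have "A v (h u)" by (rule sym)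
    then have "A (h v) (h u)" using assms(3)[of v] assms(2)[of u] uv by (simp add: twin_def)
    then show ?thesis by (rule sym)
  qed
  then have "successively A (map h p)"
    using assms(1) unfolding walk_def successively_map by (blast intro: successively_mono)
  then show ?thesis
    using assms(1,2) unfolding walk_def by (auto simp: hd_map last_map)
qed

text \<open>A conflict-free geodesic for \<open>f\<close> between suitable twins \<open>x'\<close>,
  \<open>y'\<close> is transported to \<open>x\<close>, \<open>y\<close>. The assumption
  \<open>pairs\<close> supplies its endpoints, \<open>colors\<close> the images of its other
  vertices.\<close>

lemma good_source_recolor:
  assumes good: "\<And>x. x < n \<Longrightarrow> good_source k f x"
    and colors: "\<And>v. v < n \<Longrightarrow> \<exists>w<n. twin v w \<and> g w = f v"
    and pairs: "\<And>x y. x < n \<Longrightarrow> y < n \<Longrightarrow> x \<noteq> y \<Longrightarrow> \<exists>x'<n. \<exists>y'<n. x' \<noteq> y' \<and> twin x' x \<and> twin y' y \<and>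
      f x' = g x \<and> f y' = g y"
    and x: "x < n"
  shows "good_source k g x"
  unfolding good_source_iff[OF x]
proof (intro allI impI)
  fix y assume y: "y < n" "y \<noteq> x"
  then obtain x' y' where x'y': "x' < n" "y' < n" "x' \<noteq> y'" "twin x' x" "twin y' y" "f x' = g x" "f y' = g y"
    using pairs[OF x y(1)] by blast
  obtain c p where p: "c < k" "geodesic x' y' p" "count_list (map f p) c = 1"
    using good[OF x'y'(1)] x'y' unfolding good_source_iff[OF x'y'(1)] by metis
  obtain h0 where h0: "\<And>v. v < n \<Longrightarrow> h0 v < n \<and> twin v (h0 v) \<and> g (h0 v) = f v"
    using colors by metis
  \<comment> \<open>Every vertex goes to a twin whose \<open>g\<close>-color is the old
    \<open>f\<close>-color; for the endpoints this holds by the choice of \<open>x'\<close> and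
    \<open>y'\<close>.\<close>
  define h where "h v = (if v = x' then x else if v = y' then y else h0 v)" for v
  have h: "h v < n" "twin v (h v)" "g (h v) = f v" if "v < n" for v
    using that h0 x'y' x y by (auto simp: h_def)
  have hx: "h x' = x" "h y' = y"
    using x'y' by (auto simp: h_def)
  have "walk x y (map h p)"
    using walk_map_twin[of x' y' p h] p(2) h hx by (simp add: geodesic_def)
  moreover have "length (map h p) \<le> length r" if "walk x y r" for r
  proof -
    \<comment> \<open>Minimality is pulled back: sending \<open>x\<close>, \<open>y\<close> to
      \<open>x'\<close>, \<open>y'\<close> and fixing all else turns a competitor of
      \<open>map h p\<close> into a competitor of \<open>p\<close> of the same length.\<close>
    let ?h = "\<lambda>v. if v = x then x' else if v = y then y' else v"
    have "walk (?h x) (?h y) (map ?h r)"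
      by (rule walk_map_twin[OF that]) (use x'y' twin_sym twin_refl in auto)
    then have "walk x' y' (map ?h r)"
      using y by simp
    then show ?thesis
      using p(2) unfolding geodesic_def by fastforce
  qed
  ultimately have "geodesic x y (map h p)"
    by (simp add: geodesic_def)
  \<comment> \<open>The whole list of colors is preserved, so the count survives without any
    argument about collisions under \<open>h\<close>.\<close>
  moreover have "map g (map h p) = map f p"
    using p(2) h by (auto simp: geodesic_def walk_def)
  ultimately show "\<exists>c<k. \<exists>p. geodesic x y p \<and> count_list (map g p) c = 1"
    using p by metis
qed

section \<open>Ranks within a class of twins\<close>

definition twins :: "nat \<Rightarrow> nat set" where
  "twins v = {u. u < n \<and> twin u v}"

lemma finite_twins [simp]: "finite (twins v)"
  by (simp add: twins_def)

lemma twins_eq: "twin u v \<Longrightarrow> twins u = twins v"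
  unfolding twins_def using twin_sym twin_trans by blast

lemma rank_less:
  assumes "twin u v" "u < v"
  shows "rank u < rank v"
  unfolding rank_def
proof (rule psubset_card_mono)
  have "u \<in> {w. w < v \<and> twin w v}" "u \<notin> {w. w < u \<and> twin w u}"
    using assms by auto
  moreover have "{w. w < u \<and> twin w u} \<subseteq> {w. w < v \<and> twin w v}"
    using assms twin_trans by auto
  ultimately show "{w. w < u \<and> twin w u} \<subset> {w. w < v \<and> twin w v}"
    by blast
qed simp

lemma rank_eq_iff:
  assumes "twin u v"
  shows "rank u = rank v \<longleftrightarrow> u = v"
  using rank_less[OF assms] rank_less[OF twin_sym[OF assms]] by (metis linorder_neqE_nat less_irrefl)

lemma inj_on_rank_twins: "inj_on rank (twins v)"
proof (rule inj_onI)
  fix u w assume "u \<in> twins v" "w \<in> twins v" "rank u = rank w"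
  then show "u = w"
    using rank_eq_iff[of u w] twin_sym twin_trans unfolding twins_def by blast
qed

text \<open>Ranks number a class without gaps, so a recoloring can be given as a function of the
  rank.\<close>

lemma rank_twins: "rank ` twins v = {..<card (twins v)}"
proof (rule card_subset_eq)
  show "rank ` twins v \<subseteq> {..<card (twins v)}"
  proof clarify
    fix u assume u: "u \<in> twins v"
    then have "twins u = twins v"
      by (intro twins_eq) (simp add: twins_def)
    moreover have "{w. w < u \<and> twin w u} \<subset> twins u"
      using u twin_refl by (auto simp: twins_def)
    ultimately show "rank u < card (twins v)"
      unfolding rank_def by (metis finite_twins psubset_card_mono)
  qed
qed (simp_all add: card_image inj_on_rank_twins)

text \<open>\<open>h\<close> lists the new colors of the class \<open>S\<close> of twins, in the order of the ranks.\<close>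

definition recolors :: "nat \<Rightarrow> (nat \<Rightarrow> nat) \<Rightarrow> nat set \<Rightarrow> (nat \<Rightarrow> nat) \<Rightarrow> bool" where
  "recolors k f S h \<longleftrightarrow> (\<forall>u\<in>S. k < rank u \<longrightarrow> h (rank u) = h k) \<and>
    (\<lambda>u. h (rank u)) ` S = f ` S \<and>
    (\<forall>u\<in>S. \<forall>w\<in>S. u \<noteq> w \<longrightarrow> h (rank u) = h (rank w) \<longrightarrow>
      (\<exists>u'\<in>S. \<exists>w'\<in>S. u' \<noteq> w' \<and> f u' = h (rank u) \<and> f w' = h (rank w)))"

lemma recolor_class:
  assumes "\<And>u. u < n \<Longrightarrow> f u < k"
  shows "\<exists>h. recolors k f (twins v) h"
proof -
  let ?S = "twins v"
  have lt: "rank u < card ?S" if "u \<in> ?S" for u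
    using that rank_twins by blast
  show ?thesis
  proof (cases "card ?S \<le> k + 1")
    \<comment> \<open>All ranks are at most \<open>k\<close> here, so the old colors can
      stay.\<close>
    case True
    define h where "h = f \<circ> inv_into ?S rank"
    have h: "h (rank u) = f u" if "u \<in> ?S" for u
      using that by (simp add: h_def inj_on_rank_twins)
    have "recolors k f ?S h"
      unfolding recolors_def
    proof (intro conjI)
      show "\<forall>u\<in>?S. k < rank u \<longrightarrow> h (rank u) = h k"
        using lt True by fastforce
      show "(\<lambda>u. h (rank u)) ` ?S = f ` ?S"
        using h by (simp cong: image_cong)
      show "\<forall>u\<in>?S. \<forall>w\<in>?S. u \<noteq> w \<longrightarrow> h (rank u) = h (rank w) \<longrightarrow>
        (\<exists>u'\<in>?S. \<exists>w'\<in>?S. u' \<noteq> w' \<and> f u' = h (rank u) \<and> f w' = h (rank w))"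
        using h by metis
    qed
    then show ?thesis by blast
  next
    case False
    let ?U = "f ` ?S"
    have "?U \<subseteq> {..<k}"
      using assms by (auto simp: twins_def)
    then have U: "card ?U \<le> k"
      using card_mono[of "{..<k}" ?U] by simp
    \<comment> \<open>Pigeonhole: more than \<open>k + 1\<close> vertices, at most \<open>k\<close>
      colors.\<close>
    then have "\<not> inj_on f ?S"
      using False card_image by fastforce
    then obtain d1 d2 where d: "d1 \<in> ?S" "d2 \<in> ?S" "d1 \<noteq> d2" "f d1 = f d2"
      by (auto simp: inj_on_def)
    obtain e where e: "bij_betw e {..<card ?U} ?U"
      using ex_bij_betw_nat_finite[of ?U] by (auto simp: atLeast0LessThan)
    \<comment> \<open>The first ranks list every used color once, all later ones receive the
      duplicated color \<open>f d1\<close>. No color is lost, and a repetition under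
      \<open>h\<close> can only be of \<open>f d1\<close>, which \<open>d1\<close> and
      \<open>d2\<close> already shared.\<close>
    define h where "h i = (if i < card ?U then e i else f d1)" for i
    have "recolors k f ?S h"
      unfolding recolors_def
    proof (intro conjI)
      show "\<forall>u\<in>?S. k < rank u \<longrightarrow> h (rank u) = h k"
        using U by (auto simp: h_def)
      have "{..<card ?U} \<subseteq> rank ` ?S"
        unfolding rank_twins using U False by auto
      then have "h ` {..<card ?U} \<subseteq> h ` rank ` ?S"
        by (rule image_mono)
      moreover have "h ` {..<card ?U} = e ` {..<card ?U}"
        by (rule image_cong) (auto simp: h_def)
      then have "h ` {..<card ?U} = ?U"
        using e by (simp add: bij_betw_def)
      moreover have "h i \<in> ?U" for i
        using e d(1) by (auto simp: h_def bij_betw_def)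
      ultimately show "(\<lambda>u. h (rank u)) ` ?S = ?U"
        by (auto simp: image_image)
      show "\<forall>u\<in>?S. \<forall>w\<in>?S. u \<noteq> w \<longrightarrow> h (rank u) = h (rank w) \<longrightarrow>
        (\<exists>u'\<in>?S. \<exists>w'\<in>?S. u' \<noteq> w' \<and> f u' = h (rank u) \<and> f w' = h (rank w))"
      proof (intro ballI impI)
        fix u w assume uw: "u \<in> ?S" "w \<in> ?S" "u \<noteq> w" "h (rank u) = h (rank w)"
        then have ne: "rank u \<noteq> rank w"
          using inj_on_rank_twins by (meson inj_onD)
        have "h (rank u) = f d1"
        proof (cases "rank u < card ?U \<and> rank w < card ?U")
          case True
          then have "rank u = rank w"
            using uw(4) e by (auto simp: h_def bij_betw_def inj_on_def)
          with ne show ?thesis by simp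
        next
          case False
          then show ?thesis
            using uw(4) by (auto simp: h_def split: if_splits)
        qed
        with d uw(4) show "\<exists>u'\<in>?S. \<exists>w'\<in>?S. u' \<noteq> w' \<and> f u' = h (rank u) \<and> f w' = h (rank w)"
          by metis
      qed
    qed
    then show ?thesis by blast
  qed
qed

text \<open>\<open>rep\<close> is arbitrary subject to \<open>copies\<close>, since this is all that
  is proved about the table that the program computes.\<close>

lemma canonical_coloring:
  assumes f: "\<And>u. u < n \<Longrightarrow> f u < k" and good: "\<And>x. x < n \<Longrightarrow> good_source k f x"
    and rep: "\<And>v. v < n \<Longrightarrow> copies k v (rep v)"
  obtains g where "\<And>u. u < n \<Longrightarrow> g u < k" "\<And>x. x < n \<Longrightarrow> good_source k g x" "\<And>v. v < n \<Longrightarrow> g (rep v) = g v"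
proof -
  \<comment> \<open>The choice depends on the class as a set, so twins share one listing of
    colors.\<close>
  define H where "H S = (SOME h. recolors k f S h)" for S
  have H: "recolors k f (twins v) (H (twins v))" for v
  proof -
    have "\<exists>h. recolors k f (twins v) h"
      by (rule recolor_class) (rule f)
    then show ?thesis
      unfolding H_def using someI_ex[of "recolors k f (twins v)"] by blast
  qed
  define g where "g v = H (twins v) (rank v)" for v
  have g: "H (twins v) (rank u) = g u" if "u \<in> twins v" for u v
    using that twins_eq[of u v] by (simp add: g_def twins_def)
  have self: "v \<in> twins v" if "v < n" for v
    using that twin_refl by (simp add: twins_def)
  have img: "g ` twins v = f ` twins v" for v
  proof -
    have "g ` twins v = (\<lambda>u. H (twins v) (rank u)) ` twins v"
      using g by (intro image_cong) simp_all
    then show ?thesis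
      using H[of v] by (simp add: recolors_def)
  qed
  have const: "g u = H (twins v) k" if "u \<in> twins v" "k < rank u" for u v
    using H[of v] g[OF that(1)] that by (simp add: recolors_def)
  have dup: "\<exists>u'\<in>twins v. \<exists>w'\<in>twins v. u' \<noteq> w' \<and> f u' = g u \<and> f w' = g w"
    if "u \<in> twins v" "w \<in> twins v" "u \<noteq> w" "g u = g w" for u v w
  proof -
    have "\<forall>u\<in>twins v. \<forall>w\<in>twins v. u \<noteq> w \<longrightarrow> H (twins v) (rank u) = H (twins v) (rank w) \<longrightarrow>
      (\<exists>u'\<in>twins v. \<exists>w'\<in>twins v. u' \<noteq> w' \<and> f u' = H (twins v) (rank u) \<and> f w' = H (twins v) (rank w))"
      using H[of v] unfolding recolors_def by blast
    from this[rule_format, OF that(1-3)] show ?thesis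
      unfolding g[OF that(1)] g[OF that(2)] using that(4) by blast
  qed
  show thesis
  proof
    fix v assume v: "v < n"
    have "g v \<in> f ` twins v"
      using img self[OF v] by blast
    then show "g v < k"
      using f by (auto simp: twins_def)
    show "g (rep v) = g v"
    proof (cases "rank v \<le> k")
      case True
      then show ?thesis using rep[OF v] by (simp add: copies_def)
    next
      case False
      then have r: "rep v < v" "twin (rep v) v" "rank (rep v) = k"
        using rep[OF v] by (auto simp: copies_def)
      then have "rep v \<in> twins v"
        using v by (simp add: twins_def)
      then have "g (rep v) = H (twins v) k"
        using g r(3) by metis
      also have "\<dots> = g v"
        using const[OF self[OF v]] False by simp
      finally show ?thesis .
    qed
  next
    fix x assume x: "x < n"
    show "good_source k g x"
    proof (rule good_source_recolor[OF good _ _ x])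
      fix v assume v: "v < n"
      then have "f v \<in> g ` twins v"
        using img self by blast
      then show "\<exists>w<n. twin v w \<and> g w = f v"
        using twin_sym by (auto simp: twins_def)
    next
      fix x y assume xy: "x < n" "y < n" "x \<noteq> y"
      show "\<exists>x'<n. \<exists>y'<n. x' \<noteq> y' \<and> twin x' x \<and> twin y' y \<and> f x' = g x \<and> f y' = g y"
      \<comment> \<open>Only twins of equal new color need a duplicate. Otherwise old vertices
        carrying the two colors differ in class or in color, hence are distinct.\<close>
      proof (cases "twin x y \<and> g x = g y")
        case True
        then have "x \<in> twins y" "y \<in> twins y"
          using xy self by (auto simp: twins_def)
        from dup[OF this xy(3)] True obtain x' y' where
          "x' \<in> twins y" "y' \<in> twins y" "x' \<noteq> y'" "f x' = g x" "f y' = g y"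
          by blast
        moreover have "twin x' x"
          using \<open>x' \<in> twins y\<close> True twin_sym twin_trans unfolding twins_def by blast
        ultimately show ?thesis
          by (auto simp: twins_def)
      next
        case False
        have "g x \<in> f ` twins x" "g y \<in> f ` twins y"
          using img self xy by blast+
        then obtain x' y' where x'y': "x' < n" "twin x' x" "f x' = g x" "y' < n" "twin y' y" "f y' = g y"
          unfolding twins_def by force
        moreover have "x' \<noteq> y'"
          using False x'y' twin_sym twin_trans by metis
        ultimately show ?thesis by blast
      qed
    qed simp
  qed
qed

subsection \<open>Vertex covers\<close>

text \<open>All of \<open>X\<close> is counted as free. A vertex outside has its neighborhood inside
  \<open>X\<close>, and vertices with the same neighborhood have distinct ranks in
  \<open>{..k}\<close>, which gives \<open>k + 1\<close> per subset of \<open>X\<close>.\<close>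

lemma card_free_vertices:
  assumes X: "X \<subseteq> {..<n}" and cover: "\<And>u v. A u v \<Longrightarrow> u \<in> X \<or> v \<in> X"
  shows "card {v. v < n \<and> rank v \<le> k} \<le> card X + (k + 1) * 2 ^ card X"
proof -
  have fin: "finite X"
    using X finite_subset by blast
  let ?F = "\<lambda>S. {v. v < n \<and> {w. w < n \<and> A v w} = S \<and> rank v \<le> k}"
  have "v \<in> X \<union> (\<Union>S\<in>Pow X. ?F S)" if "v < n" "rank v \<le> k" for v
  proof (cases "v \<in> X")
    case False
    then have "{w. w < n \<and> A v w} \<in> Pow X"
      using cover[of v] by blast
    moreover have "v \<in> ?F {w. w < n \<and> A v w}"
      using that by simp
    ultimately show ?thesis
      by (intro UnI2 UN_I)
  qed simp
  then have "{v. v < n \<and> rank v \<le> k} \<subseteq> X \<union> (\<Union>S\<in>Pow X. ?F S)"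
    by blast
  then have "card {v. v < n \<and> rank v \<le> k} \<le> card (X \<union> (\<Union>S\<in>Pow X. ?F S))"
  proof (rule card_mono[rotated])
    have "X \<union> (\<Union>S\<in>Pow X. ?F S) \<subseteq> {..<n}"
      using X by blast
    then show "finite (X \<union> (\<Union>S\<in>Pow X. ?F S))"
      by (rule finite_subset) simp
  qed
  also have "\<dots> \<le> card X + card (\<Union>S\<in>Pow X. ?F S)"
    by (rule card_Un_le)
  also have "card (\<Union>S\<in>Pow X. ?F S) \<le> (\<Sum>S\<in>Pow X. card (?F S))"
    using fin by (intro card_UN_le) (rule finite_Pow_iff[THEN iffD2])
  also have "\<dots> \<le> (\<Sum>S\<in>Pow X. k + 1)"
  proof (rule sum_mono)
    fix S
    have "inj_on rank (?F S)"
    proof (rule inj_onI)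
      fix u v assume uv: "u \<in> ?F S" "v \<in> ?F S" "rank u = rank v"
      then have "twin u v"
        unfolding twin_def by blast
      with uv(3) show "u = v"
        by (simp add: rank_eq_iff)
    qed
    then have "card (?F S) = card (rank ` ?F S)"
      by (simp add: card_image)
    also have "\<dots> \<le> card {..k}"
      by (intro card_mono) auto
    finally show "card (?F S) \<le> k + 1"
      by simp
  qed
  also have "\<dots> = (k + 1) * 2 ^ card X"
    using fin by (simp add: card_Pow)
  finally show ?thesis by simp
qed

lemma prod_radix: "(\<Prod>v<n. radix k v) = k ^ card {v. v < n \<and> rank v \<le> k}"
proof -
  have "(\<Prod>v<n. radix k v) = (\<Prod>v\<in>{v. v < n \<and> rank v \<le> k}. k)"
    by (rule prod.mono_neutral_cong_right) (auto simp: radix_def)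
  then show ?thesis by simp
qed

text \<open>Cover vertices get private colors below \<open>card X\<close>, the others share the
  color \<open>card X\<close>. A geodesic between distinct vertices contains a cover vertex, whose
  private color occurs once.\<close>

lemma cover_coloring:
  assumes X: "X \<subseteq> {..<n}" "card X < k" and cover: "\<And>u v. A u v \<Longrightarrow> u \<in> X \<or> v \<in> X"
    and connected: "\<And>x y. x < n \<Longrightarrow> y < n \<Longrightarrow> \<exists>p. walk x y p"
  shows "\<exists>f. (\<forall>v<n. f v < k) \<and> (\<forall>x<n. good_source k f x)"
proof -
  have fin: "finite X"
    using X finite_subset by blast
  obtain e where e: "bij_betw e X {0..<card X}"
    using ex_bij_betw_finite_nat[OF fin] by blast
  define f where "f v = (if v \<in> X then e v else card X)" for v
  have eX: "e v < card X" if "v \<in> X" for v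
    using e that by (auto simp: bij_betw_def)
  have "good_source k f x" if x: "x < n" for x
    unfolding good_source_iff[OF x]
  proof (intro allI impI)
    fix y assume y: "y < n" "y \<noteq> x"
    obtain p where p: "geodesic x y p"
      using connected[OF x y(1)] geodesic_exists by metis
    then have w: "walk x y p" by (simp add: geodesic_def)
    have "2 \<le> length p"
      using w y(2) unfolding walk_def by (cases p) (auto simp: Suc_le_eq)
    then obtain u p' where p': "p = p' @ [y]" "walk x u p'" "A u y"
      using walk_butlast[OF w] by blast
    have "u \<in> set p"
      using p' unfolding walk_def by auto
    moreover have "y \<in> set p"
      using p' by simp
    ultimately obtain v where v: "v \<in> X" "v \<in> set p"
      using cover[OF p'(3)] by blast
    have "f w = f v \<longleftrightarrow> w = v" for w
      using e eX[OF v(1)] eX v(1) by (auto simp: f_def bij_betw_def inj_on_def split: if_splits)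
    then have "{w \<in> set p. f w = f v} = {v}"
      using v(2) by auto
    then have "count_list (map f p) (f v) = 1"
      using geodesic_distinct[OF p] by (simp add: count_list_map_distinct)
    then show "\<exists>c<k. \<exists>p. geodesic x y p \<and> count_list (map f p) c = 1"
      using p eX[OF v(1)] X(2) v(1) by (intro exI[of _ "f v"]) (auto simp: f_def)
  qed
  moreover have "f v < k" for v
    using eX[of v] X(2) by (auto simp: f_def)
  ultimately show ?thesis by blast
qed

end

subsection \<open>The program\<close>

definition cell :: "string \<Rightarrow> string \<Rightarrow> aexp" where
  "cell B i = Mem (Add (Reg B) (Reg i))"

text \<open>The table \<open>row\<close> holds the address of each matrix row, because
  \<open>u * n\<close> cannot be computed in one step.\<close>

definition adjE :: "string \<Rightarrow> string \<Rightarrow> aexp" where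
  "adjE u w = Mem (Add (cell ''row'' u) (Reg w))"

text \<open>The color of a vertex is the counter digit of its representative; copied colors are
  never stored.\<close>

definition colE :: "string \<Rightarrow> aexp" where
  "colE v = Mem (Add (Reg ''dig'') (cell ''rep'' v))"

definition eqB :: "aexp \<Rightarrow> aexp \<Rightarrow> bexp" where
  "eqB a b = Conj (Neg (Less a b)) (Neg (Less b a))"

definition nzB :: "aexp \<Rightarrow> bexp" where
  "nzB a = Less (Const 0) a"

abbreviation If1 :: "bexp \<Rightarrow> com \<Rightarrow> com" where
  "If1 b P \<equiv> Cond b P Skip"

lemma aval_cell [simp]: "aval (cell B i) s = mem s (reg s B + reg s i)"
  and acost_cell [simp]: "acost (cell B i) = 4"
  and acost_adjE [simp]: "acost (adjE u w) = 7"
  and acost_colE [simp]: "acost (colE v) = 7"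
  and aval_colE [simp]: "aval (colE v) s = mem s (reg s ''dig'' + mem s (reg s ''rep'' + reg s v))"
  and bval_eqB [simp]: "bval (eqB a b) s \<longleftrightarrow> aval a s = aval b s"
  and bcost_eqB [simp]: "bcost (eqB a b) = 5 + 2 * acost a + 2 * acost b"
  and bval_nzB [simp]: "bval (nzB a) s \<longleftrightarrow> aval a s \<noteq> 0"
  and bcost_nzB [simp]: "bcost (nzB a) = 2 + acost a"
  by (auto simp: cell_def adjE_def colE_def eqB_def nzB_def)

definition relax :: com where
  "relax = For ''u'' ''n'' (If1 (nzB (adjE ''y'' ''u''))
     (Seq (If1 (nzB (cell ''cur'' ''u'')) (Assign ''e'' (Const 1)))
     (Seq (If1 (nzB (cell ''cur1'' ''u'')) (Assign ''z'' (Const 1)))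
          (If1 (nzB (cell ''cur2'' ''u'')) (Assign ''o'' (Const 1))))))"

text \<open>\<open>e\<close>, \<open>z\<close>, \<open>o\<close> become the flags of
  \<open>y\<close> for \<open>reached\<close>, \<open>none\<close>, \<open>one\<close> in the next
  layer. If \<open>y\<close> itself has color \<open>c\<close>, paths avoiding \<open>c\<close> so
  far turn into paths with one \<open>c\<close>, so \<open>o\<close> takes over
  \<open>z\<close>.\<close>

definition node_update :: com where
  "node_update = Cond (nzB (cell ''cur'' ''y''))
     (Seq (Assign ''e'' (Const 1))
     (Seq (Assign ''z'' (cell ''cur1'' ''y'')) (Assign ''o'' (cell ''cur2'' ''y''))))
     (Seq relax (If1 (eqB (colE ''y'') (Reg ''c''))
           (Seq (Assign ''o'' (Reg ''z'')) (Assign ''z'' (Const 0)))))"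

text \<open>A layer is a block of three arrays of length \<open>n\<close>; the next block begins
  \<open>n\<close> cells after \<open>cur2\<close>.\<close>

definition nxt :: aexp where
  "nxt = Add (Add (Reg ''cur2'') (Reg ''n'')) (Reg ''y'')"

definition node :: com where
  "node =
     Seq (Seq (Assign ''e'' (Const 0)) (Seq (Assign ''z'' (Const 0)) (Assign ''o'' (Const 0))))
    (Seq node_update
    (Seq (Store nxt (Reg ''e''))
    (Seq (Store (Add nxt (Reg ''n'')) (Reg ''z''))
         (Store (Add (Add nxt (Reg ''n'')) (Reg ''n'')) (Reg ''o'')))))"

definition set_cur :: "aexp \<Rightarrow> com" where
  "set_cur a = Seq (Assign ''cur'' a)
    (Seq (Assign ''cur1'' (Add (Reg ''cur'') (Reg ''n'')))
         (Assign ''cur2'' (Add (Reg ''cur1'') (Reg ''n''))))"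

definition layer :: com where
  "layer = Seq (For ''y'' ''n'' node) (set_cur (Add (Reg ''cur2'') (Reg ''n'')))"

definition start :: com where
  "start = Seq (set_cur (Reg ''base''))
    (Seq (For ''y'' ''n''
      (Seq (Store (Add (Reg ''cur'') (Reg ''y'')) (Const 0))
      (Seq (Store (Add (Reg ''cur1'') (Reg ''y'')) (Const 0))
           (Store (Add (Reg ''cur2'') (Reg ''y'')) (Const 0)))))
    (Seq (Store (Add (Reg ''cur'') (Reg ''x'')) (Const 1))
         (Cond (eqB (colE ''x'') (Reg ''c''))
           (Store (Add (Reg ''cur2'') (Reg ''x'')) (Const 1))
           (Store (Add (Reg ''cur1'') (Reg ''x'')) (Const 1)))))"

definition mark :: com where
  "mark = For ''y'' ''n'' (If1 (nzB (cell ''cur2'' ''y''))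
     (Store (Add (Reg ''ok'') (Reg ''y'')) (Const 1)))"

definition search :: com where
  "search = Seq start (Seq (For ''l'' ''n'' layer) mark)"

definition clear_ok :: com where
  "clear_ok = For ''y'' ''n'' (Store (Add (Reg ''ok'') (Reg ''y'')) (Const 0))"

text \<open>The entry of the source itself is forced to 1, since only pairs of distinct vertices
  matter.\<close>

definition verdict :: com where
  "verdict = Seq (Store (Add (Reg ''ok'') (Reg ''x'')) (Const 1))
     (For ''y'' ''n'' (If1 (Neg (nzB (cell ''ok'' ''y''))) (Assign ''good'' (Const 0))))"

definition source :: com where
  "source = Seq clear_ok (Seq (For ''c'' ''k'' search) verdict)"

definition check :: com where
  "check = Seq (Assign ''good'' (Const 1)) (For ''x'' ''n'' source)"

section \<open>Correctness of the check of one coloring\<close>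

lemma ex_less_Suc: "(\<exists>u<Suc j. P u) \<longleftrightarrow> (\<exists>u<j. P u) \<or> P j"
  by (auto simp: less_Suc_eq)

lemma all_less_Suc: "(\<forall>u<Suc j. P u) \<longleftrightarrow> (\<forall>u<j. P u) \<and> P j"
  by (auto simp: less_Suc_eq)

text \<open>\<open>k \<le> n\<close> is available because larger \<open>k\<close> never reach the
  search; it bounds the loop over the colors by \<open>n\<close> rounds.\<close>

locale layout = adjacency +
  fixes k :: nat
  assumes k_le: "k \<le> n"
begin

abbreviation q :: nat where "q \<equiv> 2 + n * n"

text \<open>\<open>q\<close> is the first address after the matrix. The vector of the cover and the
  tables \<open>row\<close>, \<open>rep\<close>, \<open>rad\<close>, \<open>dig\<close>,
  \<open>ok\<close> occupy \<open>n\<close> cells each; the layers of the search begin at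
  \<open>base\<close>.\<close>

definition base_regs :: "ram \<Rightarrow> bool" where
  "base_regs s \<longleftrightarrow> reg s ''n'' = n \<and> reg s ''k'' = k \<and> reg s ''row'' = q + n \<and>
     reg s ''rep'' = q + 2 * n \<and> reg s ''rad'' = q + 3 * n \<and> reg s ''dig'' = q + 4 * n \<and>
     reg s ''ok'' = q + 5 * n \<and> reg s ''base'' = q + 6 * n"

text \<open>It has to hold before the tables after \<open>row\<close> are filled, and therefore says
  nothing about their contents.\<close>

definition env :: "ram \<Rightarrow> bool" where
  "env s \<longleftrightarrow> base_regs s \<and> (\<forall>i<n. mem s (q + n + i) = 2 + i * n) \<and>
     (\<forall>i<n. \<forall>j<n. mem s (2 + i * n + j) = of_bool (A i j))"

lemma row_bound: "i < n \<Longrightarrow> j < n \<Longrightarrow> 2 + i * n + j < q"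
proof -
  assume "i < n" "j < n"
  then have "i * n + j < i * n + n" "Suc i * n \<le> n * n"
    by (auto simp del: mult_Suc)
  then show ?thesis by simp
qed

text \<open>The row table ends at \<open>q + 2 * n\<close>, so writing to the later tables and to
  the layers is harmless.\<close>

lemma env_cong:
  assumes "env s" "\<And>x. x \<in> {''n'', ''k'', ''row'', ''rep'', ''rad'', ''dig'', ''ok'', ''base''} \<Longrightarrow> reg s' x = reg s x"
    and "\<And>i. i < q + 2 * n \<Longrightarrow> mem s' i = mem s i"
  shows "env s'"
proof -
  have "mem s' (2 + i * n + j) = mem s (2 + i * n + j)" if "i < n" "j < n" for i j
    using row_bound[OF that] by (intro assms(3)) simp
  with assms show ?thesis
    unfolding env_def base_regs_def by simp
qed

lemma env_framed:
  assumes "env s" "framed P s s'" "store_free P"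
    "writes P \<inter> {''n'', ''k'', ''row'', ''rep'', ''rad'', ''dig'', ''ok'', ''base''} = {}"
  shows "env s'"
  using assms by (intro env_cong[OF assms(1)]) (auto simp: framed_def)

lemma aval_adjE [simp]:
  "env s \<Longrightarrow> reg s u < n \<Longrightarrow> reg s w < n \<Longrightarrow> aval (adjE u w) s = of_bool (A (reg s u) (reg s w))"
  unfolding adjE_def env_def base_regs_def by simp

lemma base_regs_simps:
  assumes "env s"
  shows "reg s ''n'' = n" "reg s ''k'' = k" "reg s ''row'' = q + n"
    "reg s ''rep'' = q + 2 * n" "reg s ''rad'' = q + 3 * n" "reg s ''dig'' = q + 4 * n"
    "reg s ''ok'' = q + 5 * n" "reg s ''base'' = q + 6 * n"
  using assms by (auto simp: env_def base_regs_def)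

definition arr :: "ram \<Rightarrow> nat \<Rightarrow> (nat \<Rightarrow> bool) \<Rightarrow> bool" where
  "arr s b p \<longleftrightarrow> (\<forall>i<n. mem s (b + i) = of_bool (p i))"

lemma relax_correct:
  assumes env: "env s" and y: "reg s ''y'' < n"
    and init: "reg s ''e'' = 0" "reg s ''z'' = 0" "reg s ''o'' = 0"
    and arr: "arr s (reg s ''cur'') E" "arr s (reg s ''cur1'') Z" "arr s (reg s ''cur2'') O'"
  shows "runs relax s (100 * n) (\<lambda>s'.
    reg s' ''e'' = of_bool (\<exists>u<n. A (reg s ''y'') u \<and> E u) \<and>
    reg s' ''z'' = of_bool (\<exists>u<n. A (reg s ''y'') u \<and> Z u) \<and>
    reg s' ''o'' = of_bool (\<exists>u<n. A (reg s ''y'') u \<and> O' u))"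
proof -
  let ?I = "\<lambda>j s'.
    reg s' ''e'' = of_bool (\<exists>u<j. A (reg s ''y'') u \<and> E u) \<and>
    reg s' ''z'' = of_bool (\<exists>u<j. A (reg s ''y'') u \<and> Z u) \<and>
    reg s' ''o'' = of_bool (\<exists>u<j. A (reg s ''y'') u \<and> O' u)"
  show ?thesis
    unfolding relax_def
  \<comment> \<open>A round of the body costs at most 80, so the loop takes
    \<open>n * (80 + 14)\<close>. Time constants are rounded up generously throughout.\<close>
  proof (rule runs_For_le[where n = n and I = ?I and B = 80], goal_cases)
    case (7 j s')
    have env': "env s'"
      using env_framed[OF env 7(4)] by simp
    have f: "reg s' ''y'' = reg s ''y''" "reg s' ''cur'' = reg s ''cur''" "reg s' ''cur1'' = reg s ''cur1''"
      "reg s' ''cur2'' = reg s ''cur2''" "mem s' = mem s"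
      using framed_reg[OF 7(4)] framed_mem[OF 7(4)] by auto
    have j: "j < n"
      using 7(1) env by (simp add: base_regs_simps)
    show ?case
      using env' f y j 7(2,3) arr
      by (intro runs_wp; cases "A (reg s ''y'') j"; cases "E j"; cases "Z j"; cases "O' j")
        (simp_all add: ex_less_Suc arr_def)
  qed (use env init n_pos in \<open>auto simp: base_regs_simps\<close>)
qed

text \<open>The bound on the representative keeps the digit read below \<open>q + 5 * n\<close>, so
  that writing to \<open>ok\<close> and to the layers cannot change the coloring.\<close>

definition colored :: "ram \<Rightarrow> (nat \<Rightarrow> nat) \<Rightarrow> bool" where
  "colored s f \<longleftrightarrow> (\<forall>v<n. mem s (q + 2 * n + v) < n \<and> mem s (q + 4 * n + mem s (q + 2 * n + v)) = f v)"

lemma colored_cong: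
  assumes "colored s f" "\<And>i. i < q + 5 * n \<Longrightarrow> mem s' i = mem s i"
  shows "colored s' f"
  using assms unfolding colored_def by simp

lemma aval_colE_colored:
  assumes "env s" "colored s f" "reg s v < n"
  shows "mem s (reg s ''dig'' + mem s (reg s ''rep'' + reg s v)) = f (reg s v)"
  using assms by (simp add: colored_def base_regs_simps)

text \<open>Each layer of the search occupies a fresh block of memory, so that nothing has to be copied.\<close>

definition layer_at :: "ram \<Rightarrow> nat \<Rightarrow> (nat \<Rightarrow> bool) \<Rightarrow> (nat \<Rightarrow> bool) \<Rightarrow> (nat \<Rightarrow> bool) \<Rightarrow> bool" where
  "layer_at s b E Z W \<longleftrightarrow> q + 6 * n \<le> b \<and> reg s ''cur'' = b \<and> reg s ''cur1'' = b + n \<and>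
     reg s ''cur2'' = b + 2 * n \<and> arr s b E \<and> arr s (b + n) Z \<and> arr s (b + 2 * n) W"

lemma node_update_correct:
  assumes env: "env s" and f: "colored s f" and y: "reg s ''y'' = y" "y < n" and c: "reg s ''c'' = c"
    and init: "reg s ''e'' = 0" "reg s ''z'' = 0" "reg s ''o'' = 0"
    and layer: "layer_at s b E Z W"
  shows "runs node_update s (150 * n) (\<lambda>s'.
    reg s' ''e'' = of_bool (E y \<or> (\<exists>u<n. A y u \<and> E u)) \<and>
    reg s' ''z'' = of_bool (if E y then Z y else f y \<noteq> c \<and> (\<exists>u<n. A y u \<and> Z u)) \<and>
    reg s' ''o'' = of_bool (if E y then W y else if f y = c then \<exists>u<n. A y u \<and> Z u else \<exists>u<n. A y u \<and> W u))"
  (is "runs _ _ _ ?Q")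
  unfolding node_update_def
proof (rule runs_Cond_le[where T' = "140 * n"], goal_cases)
  case 1
  then show ?case
    using layer y n_pos by (intro runs_wp) (simp_all add: layer_at_def arr_def)
next
  case 2
  then have nE: "\<not> E y"
    using layer y by (simp add: layer_at_def arr_def)
  have "runs relax s (100 * n) (\<lambda>s'.
    reg s' ''e'' = of_bool (\<exists>u<n. A (reg s ''y'') u \<and> E u) \<and>
    reg s' ''z'' = of_bool (\<exists>u<n. A (reg s ''y'') u \<and> Z u) \<and>
    reg s' ''o'' = of_bool (\<exists>u<n. A (reg s ''y'') u \<and> W u))"
    by (rule relax_correct) (use assms in \<open>auto simp: layer_at_def\<close>)
  then show ?case
  proof (rule runs_Seq_le[where ?T2.0 = "40 * n"])
    fix s' assume s': "framed relax s s'" "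
      reg s' ''e'' = of_bool (\<exists>u<n. A (reg s ''y'') u \<and> E u) \<and>
      reg s' ''z'' = of_bool (\<exists>u<n. A (reg s ''y'') u \<and> Z u) \<and>
      reg s' ''o'' = of_bool (\<exists>u<n. A (reg s ''y'') u \<and> W u)"
    have fr: "env s'" "mem s' = mem s" "reg s' ''y'' = y" "reg s' ''c'' = c"
      using env_framed[OF env s'(1)] framed_mem[OF s'(1)] framed_reg[OF s'(1)] y c
      by (auto simp: relax_def)
    have "colored s' f"
      using f fr by (simp add: colored_def)
    from aval_colE_colored[OF fr(1) this, of "''y''"] fr y have "aval (colE ''y'') s' = f y"
      by simp
    then show "runs (If1 (eqB (colE ''y'') (Reg ''c'')) (Seq (Assign ''o'' (Reg ''z'')) (Assign ''z'' (Const 0)))) s'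
      (40 * n) ?Q"
      using fr s'(2) nE y n_pos by (intro runs_wp) (simp_all del: aval_colE)
  qed simp
qed (use n_pos in simp)

text \<open>The stored values are the recursion equations of \<open>reached\<close>,
  \<open>none\<close> and \<open>one\<close>, with the old layer abstracted to \<open>E\<close>,
  \<open>Z\<close>, \<open>W\<close>.\<close>

lemma node_correct:
  assumes env: "env s" and f: "colored s f" and y: "reg s ''y'' = y" "y < n" and c: "reg s ''c'' = c"
    and layer: "layer_at s b E Z W"
  shows "runs node s (200 * n) (\<lambda>s'. mem s' = (mem s)
    (b + 3 * n + y := of_bool (E y \<or> (\<exists>u<n. A y u \<and> E u)),
     b + 4 * n + y := of_bool (if E y then Z y else f y \<noteq> c \<and> (\<exists>u<n. A y u \<and> Z u)),
     b + 5 * n + y := of_bool (if E y then W y else if f y = c then \<exists>u<n. A y u \<and> Z u else \<exists>u<n. A y u \<and> W u)))"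
  (is "runs _ _ _ ?Q")
  unfolding node_def
proof (rule runs_Seq_le[where ?Q1.0 = "\<lambda>s'. reg s' ''e'' = 0 \<and> reg s' ''z'' = 0 \<and> reg s' ''o'' = 0"
      and ?T1.0 = 6 and ?T2.0 = "190 * n"], goal_cases)
  case 1
  show ?case by (rule runs_wp) simp_all
next
  case (2 s1)
  have s1: "env s1" "mem s1 = mem s" "reg s1 ''y'' = y" "reg s1 ''c'' = c"
    using env_framed[OF env 2(1)] framed_mem[OF 2(1)] framed_reg[OF 2(1)] y c by auto
  moreover have "colored s1 f" "layer_at s1 b E Z W"
    using f layer s1 framed_reg[OF 2(1)] by (simp_all add: colored_def layer_at_def arr_def)
  ultimately have "runs node_update s1 (150 * n) (\<lambda>s'.
    reg s' ''e'' = of_bool (E y \<or> (\<exists>u<n. A y u \<and> E u)) \<and>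
    reg s' ''z'' = of_bool (if E y then Z y else f y \<noteq> c \<and> (\<exists>u<n. A y u \<and> Z u)) \<and>
    reg s' ''o'' = of_bool (if E y then W y else if f y = c then \<exists>u<n. A y u \<and> Z u else \<exists>u<n. A y u \<and> W u))"
    by (intro node_update_correct) (use 2 y in auto)
  then show ?case
  proof (rule runs_Seq_le[where ?T2.0 = "40 * n"], goal_cases)
    case (1 s2)
    have "env s2" "mem s2 = mem s" "reg s2 ''y'' = y" "reg s2 ''cur2'' = b + 2 * n"
      using env_framed[OF s1(1) 1(1)] framed_mem[OF 1(1)] framed_reg[OF 1(1)] s1 \<open>layer_at s1 b E Z W\<close>
      by (auto simp: node_update_def relax_def layer_at_def)
    then show ?case
      using 1(2) n_pos by (intro runs_wp) (simp_all add: base_regs_simps nxt_def algebra_simps)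
  qed simp
qed (use n_pos in simp)

lemma env_reg [simp]:
  assumes "x \<notin> {''n'', ''k'', ''row'', ''rep'', ''rad'', ''dig'', ''ok'', ''base''}"
  shows "env (s\<lparr>reg := r(x := v)\<rparr>) \<longleftrightarrow> env (s\<lparr>reg := r\<rparr>)"
proof -
  have "y \<noteq> x" if "y \<in> {''n'', ''k'', ''row'', ''rep'', ''rad'', ''dig'', ''ok'', ''base''}" for y
    using assms that by metis
  then show ?thesis
    by (intro iffI; elim env_cong) simp_all
qed

lemma writes_relax [simp]: "writes relax = {''u'', ''e'', ''z'', ''o''}"
  and writes_node_update [simp]: "writes node_update = {''u'', ''e'', ''z'', ''o''}"
  and writes_node [simp]: "writes node = {''u'', ''e'', ''z'', ''o''}"
  and writes_set_cur [simp]: "writes (set_cur a) = {''cur'', ''cur1'', ''cur2''}"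
  by (auto simp: relax_def node_update_def node_def set_cur_def)

lemma writes_layer [simp]: "writes layer = {''y'', ''u'', ''e'', ''z'', ''o'', ''cur'', ''cur1'', ''cur2''}"
  by (auto simp: layer_def)

text \<open>\<open>s0\<close> is the state before the search, whose tables must survive. The address
  \<open>b\<close> of the current layer is existential, because only its contents matter.\<close>

definition searching :: "(nat \<Rightarrow> nat) \<Rightarrow> nat \<Rightarrow> nat \<Rightarrow> ram \<Rightarrow> nat \<Rightarrow> ram \<Rightarrow> bool" where
  "searching f c x s0 l s \<longleftrightarrow> env s \<and> reg s ''c'' = c \<and> reg s ''x'' = x \<and>
     (\<forall>i<q + 6 * n. mem s i = mem s0 i) \<and>
     (\<exists>b. layer_at s b (reached x l) (none f c x l) (one f c x l))"

lemma layer_correct: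
  assumes s: "searching f c x s0 l s" and f: "colored s0 f"
  shows "runs layer s (300 * n ^ 2) (searching f c x s0 (Suc l))"
proof -
  obtain b where b: "layer_at s b (reached x l) (none f c x l) (one f c x l)"
    using s by (auto simp: searching_def)
  have env: "env s" and low: "\<And>i. i < q + 6 * n \<Longrightarrow> mem s i = mem s0 i"
    using s by (auto simp: searching_def)
  have bge: "q + 6 * n \<le> b"
    using b by (simp add: layer_at_def)
  \<comment> \<open>The cells below \<open>b + 3 * n\<close> include the old layer, so every vertex
    is updated from unmodified data.\<close>
  let ?I = "\<lambda>j s'. (\<forall>i<b + 3 * n. mem s' i = mem s i) \<and>
    (\<forall>i<j. mem s' (b + 3 * n + i) = of_bool (reached x (Suc l) i) \<and>
           mem s' (b + 4 * n + i) = of_bool (none f c x (Suc l) i) \<and>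
           mem s' (b + 5 * n + i) = of_bool (one f c x (Suc l) i))"
  have "runs (For ''y'' ''n'' node) s (250 * n ^ 2) (?I n)"
  proof (rule runs_For_le[where n = n and I = ?I and B = "200 * n"], goal_cases)
    case (7 j s')
    have rg: "reg s' r = reg s r"
      if "r \<in> {''n'', ''k'', ''row'', ''rep'', ''rad'', ''dig'', ''ok'', ''base'', ''c'', ''cur'', ''cur1'', ''cur2''}" for r
      by (rule framed_reg[OF 7(4)]) (use that in \<open>elim insertE emptyE; simp\<close>)
    have mm: "\<forall>i<b + 3 * n. mem s' i = mem s i"
      using 7(2) by simp
    have j: "j < n"
      using 7(1) env by (simp add: base_regs_simps)
    have env': "env s'"
      by (rule env_cong[OF env]) (use rg mm bge in auto)
    have col: "colored s' f"
      by (rule colored_cong[OF f]) (use low mm bge in auto)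
    have lay: "layer_at s' b (reached x l) (none f c x l) (one f c x l)"
      using b rg mm by (simp add: layer_at_def arr_def)
    have c: "reg s' ''c'' = c"
      using s rg by (simp add: searching_def)
    show ?case
    proof (rule runs_mono[OF node_correct[OF env' col 7(3) j c lay] order_refl])
      fix s'' assume "mem s'' = (mem s')
        (b + 3 * n + j := of_bool (reached x l j \<or> (\<exists>u<n. A j u \<and> reached x l u)),
         b + 4 * n + j := of_bool (if reached x l j then none f c x l j
            else f j \<noteq> c \<and> (\<exists>u<n. A j u \<and> none f c x l u)),
         b + 5 * n + j := of_bool (if reached x l j then one f c x l j
            else if f j = c then \<exists>u<n. A j u \<and> none f c x l u else \<exists>u<n. A j u \<and> one f c x l u))"
      then have "mem s'' = (mem s')
        (b + 3 * n + j := of_bool (reached x (Suc l) j),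
         b + 4 * n + j := of_bool (none f c x (Suc l) j),
         b + 5 * n + j := of_bool (one f c x (Suc l) j))"
        by simp
      then have "\<And>i. i < b + 3 * n \<Longrightarrow> mem s'' i = mem s' i"
          "\<And>i. i < j \<Longrightarrow> mem s'' (b + 3 * n + i) = mem s' (b + 3 * n + i)"
          "\<And>i. i < j \<Longrightarrow> mem s'' (b + 4 * n + i) = mem s' (b + 4 * n + i)"
          "\<And>i. i < j \<Longrightarrow> mem s'' (b + 5 * n + i) = mem s' (b + 5 * n + i)"
          "mem s'' (b + 3 * n + j) = of_bool (reached x (Suc l) j)"
          "mem s'' (b + 4 * n + j) = of_bool (none f c x (Suc l) j)"
          "mem s'' (b + 5 * n + j) = of_bool (one f c x (Suc l) j)"
        using j by (simp_all del: reached.simps none.simps one.simps)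
      then show "?I (Suc j) (s''\<lparr>reg := (reg s'')(''y'' := Suc j)\<rparr>)"
        using 7(2) by (simp add: all_less_Suc del: reached.simps none.simps one.simps)
    qed
  next
    case (8 s')
    then show ?case using env by (simp add: base_regs_simps)
  next
    case 9
    have "n * (200 * n + 14) \<le> 250 * n ^ Suc 1"
      by (rule loop_time[of _ _ 200 1 0]) (use n_pos in auto)
    then show ?case by (simp add: numeral_2_eq_2)
  qed (use env n_pos in \<open>auto simp: base_regs_simps\<close>)
  then show ?thesis
    unfolding layer_def
  proof (rule runs_Seq_le[where ?T2.0 = 12], goal_cases)
    case (1 s')
    have rg: "reg s' r = reg s r"
      if "r \<in> {''n'', ''k'', ''row'', ''rep'', ''rad'', ''dig'', ''ok'', ''base'', ''c'', ''x'', ''cur'', ''cur1'', ''cur2''}" for r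
      by (rule framed_reg[OF 1(1)]) (use that in \<open>elim insertE emptyE; simp\<close>)
    have env': "env s'"
      by (rule env_cong[OF env]) (use rg 1(2) bge in auto)
    let ?s = "s'\<lparr>reg := (reg s')(''cur'' := b + 3 * n, ''cur1'' := b + 4 * n, ''cur2'' := b + 5 * n)\<rparr>"
    have "layer_at ?s (b + 3 * n) (reached x (Suc l)) (none f c x (Suc l)) (one f c x (Suc l))"
      using 1(2) bge by (simp add: layer_at_def arr_def algebra_simps del: reached.simps none.simps one.simps)
    moreover have "env ?s"
      using env' by simp
    ultimately have "searching f c x s0 (Suc l) ?s"
      using s rg 1(2) bge low unfolding searching_def by (intro conjI exI[of _ "b + 3 * n"]) simp_all
    moreover have "reg s' ''cur2'' = b + 2 * n" "reg s' ''n'' = n"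
      using rg b env by (simp_all add: layer_at_def base_regs_simps)
    ultimately show ?case
      using n_pos by (intro runs_wp) (simp_all add: set_cur_def algebra_simps)
  qed (use zero_less_power[OF n_pos, of 2] in linarith)
qed

lemma writes_start [simp]: "writes start = {''y'', ''cur'', ''cur1'', ''cur2''}"
  and writes_mark [simp]: "writes mark = {''y''}"
  by (auto simp: start_def mark_def)

lemma writes_search [simp]:
  "writes search = {''y'', ''u'', ''e'', ''z'', ''o'', ''cur'', ''cur1'', ''cur2'', ''l''}"
  by (auto simp: search_def)

text \<open>The first block may hold remains of an earlier search and is cleared. Later blocks need
  no clearing, as \<open>node\<close> overwrites each of their cells.\<close>

lemma start_correct:
  assumes env: "env s" and f: "colored s f" and x: "reg s ''x'' = x" "x < n" and c: "reg s ''c'' = c"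
  shows "runs start s (100 * n) (searching f c x s 0)"
  unfolding start_def
proof (rule runs_Seq_le[where ?Q1.0 = "\<lambda>s'. reg s' ''cur'' = q + 6 * n \<and> reg s' ''cur1'' = q + 7 * n \<and>
      reg s' ''cur2'' = q + 8 * n \<and> mem s' = mem s" and ?T1.0 = 10 and ?T2.0 = "90 * n"], goal_cases)
  case 1
  then show ?case
    using env by (intro runs_wp) (simp_all add: set_cur_def base_regs_simps)
next
  case (2 s1)
  have rg: "reg s1 r = reg s r"
    if "r \<in> {''n'', ''k'', ''row'', ''rep'', ''rad'', ''dig'', ''ok'', ''base'', ''c'', ''x''}" for r
    by (rule framed_reg[OF 2(1)]) (use that in \<open>elim insertE emptyE; simp\<close>)
  have env1: "env s1"
    by (rule env_cong[OF env]) (use rg 2(2) in auto)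
  let ?b = "q + 6 * n"
  let ?I = "\<lambda>j s'. (\<forall>i<?b. mem s' i = mem s i) \<and>
    (\<forall>i<j. mem s' (?b + i) = 0 \<and> mem s' (?b + n + i) = 0 \<and> mem s' (?b + 2 * n + i) = 0)"
  show ?case
  proof (rule runs_Seq_le[where ?Q1.0 = "?I n" and ?T1.0 = "40 * n" and ?T2.0 = "50 * n"], goal_cases)
    case 1
    show ?case
    proof (rule runs_For_le[where n = n and I = ?I and B = 20], goal_cases)
      case (7 j s')
      have j: "j < n"
        using 7(1) env1 by (simp add: base_regs_simps)
      have "reg s' ''cur'' = ?b" "reg s' ''cur1'' = ?b + n" "reg s' ''cur2'' = ?b + 2 * n"
        using framed_reg[OF 7(4)] 2(2) by simp_all
      then show ?case
        using 7(2,3) j by (intro runs_wp) (auto simp: all_less_Suc)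
    qed (use env1 n_pos 2 in \<open>simp_all add: base_regs_simps\<close>)
  next
    case (2 s2)
    have rg2: "reg s2 r = reg s1 r"
      if "r \<in> {''n'', ''k'', ''row'', ''rep'', ''rad'', ''dig'', ''ok'', ''base'', ''c'', ''x'', ''cur'', ''cur1'', ''cur2''}" for r
      by (rule framed_reg[OF 2(1)]) (use that in \<open>elim insertE emptyE; simp\<close>)
    have env2: "env s2"
      by (rule env_cong[OF env1]) (use rg2 2(2) \<open>_ \<and> _ \<and> _ \<and> mem s1 = mem s\<close> in auto)
    have f2: "colored s2 f"
      by (rule colored_cong[OF f]) (use 2(2) in auto)
    have x2: "reg s2 ''x'' = x" "reg s2 ''c'' = c"
      "reg s2 ''cur'' = ?b" "reg s2 ''cur1'' = ?b + n" "reg s2 ''cur2'' = ?b + 2 * n"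
      using rg rg2 x c \<open>_ \<and> _ \<and> _ \<and> mem s1 = mem s\<close> by simp_all
    have post: "searching f c x s 0 s'" if s': "reg s' = reg s2"
        "mem s' = (mem s2)(?b + x := 1, (if f x = c then ?b + 2 * n + x else ?b + n + x) := 1)" for s'
    proof -
      have "env s'"
        by (rule env_cong[OF env2]) (use s' in auto)
      moreover have "\<forall>i<?b. mem s' i = mem s i"
        using 2(2) s' by auto
      moreover have "arr s' ?b (\<lambda>y. y = x)" "arr s' (?b + n) (\<lambda>y. y = x \<and> f x \<noteq> c)"
          "arr s' (?b + 2 * n) (\<lambda>y. y = x \<and> f x = c)"
        using 2(2) s' x(2) unfolding arr_def by auto
      ultimately show ?thesis
        unfolding searching_def layer_at_def using s' x2 by auto
    qed
    \<comment> \<open>The color of \<open>x\<close> is read only after the first store, so the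
      coloring has to be known in this intermediate state.\<close>
    let ?s3 = "s2\<lparr>mem := (mem s2)(?b + x := 1)\<rparr>"
    have "env ?s3" "colored ?s3 f"
      by (rule env_cong[OF env2] colored_cong[OF f2]; simp)+
    from aval_colE_colored[OF this, of "''x''"] x x2 have fx: "aval (colE ''x'') ?s3 = f x"
      by simp
    show ?case
    proof (rule runs_wp, goal_cases)
      case 1
      show ?case
        using fx post x2 by (cases "f x = c") (simp_all del: aval_colE)
    qed (use n_pos in simp)
  qed simp
qed (use n_pos in simp)

lemma mark_correct:
  assumes env: "env s" and W: "arr s b W" "reg s ''cur2'' = b" "q + 6 * n \<le> b"
    and ok: "arr s (q + 5 * n) Y"
  shows "runs mark s (50 * n) (\<lambda>s'. (\<forall>i<q + 5 * n. mem s' i = mem s i) \<and>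
     arr s' (q + 5 * n) (\<lambda>y. Y y \<or> W y))"
  unfolding mark_def
\<comment> \<open>All cells outside \<open>ok\<close> are protected, not just those below it: the
  array \<open>W\<close> that is being read lies above.\<close>
proof (rule runs_For_le[where n = n and B = 30 and I = "\<lambda>j s'.
     (\<forall>i. i \<notin> {q + 5 * n..<q + 6 * n} \<longrightarrow> mem s' i = mem s i) \<and>
     arr s' (q + 5 * n) (\<lambda>y. Y y \<or> (y < j \<and> W y))"], goal_cases)
  case (7 j s')
  have j: "j < n"
    using 7(1) env by (simp add: base_regs_simps)
  have rg: "reg s' ''cur2'' = b" "reg s' ''ok'' = q + 5 * n"
    using framed_reg[OF 7(4)] W env by (simp_all add: base_regs_simps)
  have W': "mem s' (b + j) = of_bool (W j)"
    using W j 7(2) by (simp add: arr_def)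
  show ?case
  proof (cases "W j")
    case True
    then show ?thesis
      using rg 7(2,3) j W' by (intro runs_wp) (auto simp: arr_def less_Suc_eq)
  next
    case False
    then have "(\<lambda>y. Y y \<or> y < Suc j \<and> W y) = (\<lambda>y. Y y \<or> y < j \<and> W y)"
      by (auto simp: less_Suc_eq)
    with False show ?thesis
      using rg 7(2,3) j W' by (intro runs_wp) (simp_all add: arr_def)
  qed
qed (use env n_pos ok in \<open>auto simp: base_regs_simps arr_def\<close>)

text \<open>\<open>Y\<close> stands for the vertices already served by earlier colors; one search
  adds those served by \<open>c\<close>.\<close>

lemma search_correct:
  assumes env: "env s" and f: "colored s f" and x: "reg s ''x'' = x" "x < n" and c: "reg s ''c'' = c"
    and ok: "arr s (q + 5 * n) Y"
  shows "runs search s (500 * n ^ 3) (\<lambda>s'. (\<forall>i<q + 5 * n. mem s' i = mem s i) \<and>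
     arr s' (q + 5 * n) (\<lambda>y. Y y \<or> one f c x n y))"
  unfolding search_def
proof (rule runs_Seq_le[OF start_correct[OF env f x c], where ?T2.0 = "400 * n ^ 3"], goal_cases)
  case (1 s1)
  then have e1: "env s1"
    by (simp add: searching_def)
  have "runs (For ''l'' ''n'' layer) s1 (320 * n ^ 3) (searching f c x s n)"
  proof (rule runs_For_le[where n = n and B = "300 * n ^ 2" and I = "searching f c x s"], goal_cases)
    case 6
    show ?case
      using 1(2) by (auto simp: searching_def layer_at_def arr_def)
  next
    case (7 j s')
    show ?case
    proof (rule runs_mono[OF layer_correct[OF 7(2) f] order_refl])
      fix s'' assume "searching f c x s (Suc j) s''"
      then show "searching f c x s (Suc j) (s''\<lparr>reg := (reg s'')(''l'' := Suc j)\<rparr>)"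
        unfolding searching_def layer_at_def arr_def by simp
    qed
  next
    case 9
    have "n * (300 * n ^ 2 + 14) \<le> 320 * n ^ Suc 2"
      by (rule loop_time[of _ _ 300 2 0]) (use n_pos in auto)
    then show ?case by (simp add: eval_nat_numeral)
  qed (use e1 n_pos in \<open>simp_all add: base_regs_simps\<close>)
  then show ?case
  proof (rule runs_Seq_le[where ?T2.0 = "50 * n"], goal_cases)
    case (1 s2)
    then obtain b where b: "layer_at s2 b (reached x n) (none f c x n) (one f c x n)"
      and s2: "env s2" "\<And>i. i < q + 6 * n \<Longrightarrow> mem s2 i = mem s i"
      by (auto simp: searching_def)
    have "arr s2 (q + 5 * n) Y"
      using ok s2(2) by (simp add: arr_def)
    with b have "runs mark s2 (50 * n) (\<lambda>s'. (\<forall>i<q + 5 * n. mem s' i = mem s2 i) \<and>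
       arr s' (q + 5 * n) (\<lambda>y. Y y \<or> one f c x n y))"
      by (intro mark_correct[OF s2(1)]) (auto simp: layer_at_def)
    then show ?case
      by (rule runs_mono) (use s2(2) in auto)
  next
    case 2
    have "n \<le> n ^ 3"
      using n_pos by (intro self_le_power) auto
    then show ?case by simp
  qed
next
  case 2
  have "n \<le> n ^ 3"
    using n_pos by (intro self_le_power) auto
  then show ?case by simp
qed

lemma writes_verdict [simp]: "writes verdict = {''y'', ''good''}"
  and writes_clear_ok [simp]: "writes clear_ok = {''y''}"
  by (auto simp: verdict_def clear_ok_def)

lemma writes_source [simp]:
  "writes source = {''y'', ''u'', ''e'', ''z'', ''o'', ''cur'', ''cur1'', ''cur2'', ''l'', ''c'', ''good''}"
  by (auto simp: source_def)

lemma clear_ok_correct: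
  assumes env: "env s"
  shows "runs clear_ok s (30 * n) (\<lambda>s'. (\<forall>i<q + 5 * n. mem s' i = mem s i) \<and> arr s' (q + 5 * n) (\<lambda>_. False))"
  unfolding clear_ok_def
proof (rule runs_For_le[where n = n and B = 10 and I = "\<lambda>j s'. (\<forall>i<q + 5 * n. mem s' i = mem s i) \<and>
    (\<forall>i<j. mem s' (q + 5 * n + i) = 0)"], goal_cases)
  case (7 j s')
  have "reg s' ''ok'' = q + 5 * n"
    using framed_reg[OF 7(4)] env by (simp add: base_regs_simps)
  then show ?case
    using 7(2,3) by (intro runs_wp) (simp_all add: all_less_Suc)
qed (use env n_pos in \<open>simp_all add: base_regs_simps arr_def\<close>)

lemma verdict_correct:
  assumes env: "env s" and ok: "arr s (q + 5 * n) Y" and x: "reg s ''x'' = x" "x < n"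
  shows "runs verdict s (60 * n) (\<lambda>s'. (\<forall>i<q + 5 * n. mem s' i = mem s i) \<and>
     reg s' ''good'' = (if \<forall>y<n. y \<noteq> x \<longrightarrow> Y y then reg s ''good'' else 0))"
  unfolding verdict_def
proof (rule runs_Seq_le[where ?Q1.0 = "\<lambda>s'. mem s' = (mem s)(q + 5 * n + x := 1)" and ?T1.0 = 10
    and ?T2.0 = "40 * n"], goal_cases)
  case 1
  show ?case
    using x env by (intro runs_wp) (simp_all add: base_regs_simps)
next
  case (2 s1)
  let ?P = "\<lambda>y. y \<noteq> x \<longrightarrow> Y y"
  have rg: "reg s1 ''n'' = n" "reg s1 ''ok'' = q + 5 * n" "reg s1 ''good'' = reg s ''good''"
    using framed_reg[OF 2(1)] env by (simp_all add: base_regs_simps)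
  have arr: "mem s1 (q + 5 * n + y) = of_bool (?P y)" if "y < n" for y
    using 2(2) ok that by (simp add: arr_def)
  show ?case
  proof (rule runs_For_le[where n = n and B = 20 and I = "\<lambda>j s'. mem s' = mem s1 \<and>
      reg s' ''good'' = (if \<forall>y<j. ?P y then reg s ''good'' else 0)"], goal_cases)
    case (7 j s')
    have "reg s' ''ok'' = q + 5 * n"
      using framed_reg[OF 7(4)] rg by simp
    moreover have "mem s' (q + 5 * n + j) = of_bool (?P j)"
      using 7(1,2) arr rg by simp
    ultimately show ?case
      using 7(2,3) by (intro runs_wp; cases "?P j") (simp_all add: all_less_Suc)
  next
    case (8 s')
    then show ?case
      using 2(2) rg(1) by simp
  qed (use rg n_pos in simp_all)
qed (use n_pos in simp)

text \<open>At most \<open>n\<close> searches of cost \<open>n ^ 3\<close>; their disjunction in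
  \<open>ok\<close> realizes the existential quantifier over colors in
  \<open>good_source\<close>.\<close>

lemma source_correct:
  assumes env: "env s" and f: "colored s f" and x: "reg s ''x'' = x" "x < n"
  shows "runs source s (700 * n ^ 4) (\<lambda>s'. (\<forall>i<q + 5 * n. mem s' i = mem s i) \<and>
     reg s' ''good'' = (if good_source k f x then reg s ''good'' else 0))"
proof -
  let ?o = "q + 5 * n"
  have n4: "n \<le> n ^ 4"
    using n_pos by (intro self_le_power) auto
  show ?thesis
    unfolding source_def
  proof (rule runs_Seq_le[OF clear_ok_correct[OF env], where ?T2.0 = "600 * n ^ 4"], goal_cases)
    case (1 s1)
    have rg: "reg s1 r = reg s r"
      if "r \<in> {''n'', ''k'', ''row'', ''rep'', ''rad'', ''dig'', ''ok'', ''base'', ''x'', ''good''}" for r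
      by (rule framed_reg[OF 1(1)]) (use that in \<open>elim insertE emptyE; simp\<close>)
    have env1: "env s1"
      by (rule env_cong[OF env]) (use rg 1(2) in auto)
    let ?I2 = "\<lambda>j s'. (\<forall>i<?o. mem s' i = mem s i) \<and> arr s' ?o (\<lambda>y. \<exists>c<j. one f c x n y)"
    have "runs (For ''c'' ''k'' search) s1 (520 * n ^ 4) (?I2 k)"
    proof (rule runs_For_le[where n = n and B = "500 * n ^ 3" and I = ?I2], goal_cases)
      case 6
      show ?case using 1(2) by (simp add: arr_def)
    next
      case (7 j s')
      have rg': "reg s' r = reg s1 r"
        if "r \<in> {''n'', ''k'', ''row'', ''rep'', ''rad'', ''dig'', ''ok'', ''base'', ''x''}" for r
        by (rule framed_reg[OF 7(4)]) (use that in \<open>elim insertE emptyE; simp\<close>)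
      have e: "env s'"
        by (rule env_cong[OF env1]) (use rg' 7(2) 1(2) in auto)
      have "colored s' f"
        by (rule colored_cong[OF f]) (use 7(2) in auto)
      moreover have "reg s' ''x'' = x"
        using rg'[of "''x''"] rg[of "''x''"] x by simp
      ultimately have "runs search s' (500 * n ^ 3) (\<lambda>s''. (\<forall>i<?o. mem s'' i = mem s' i) \<and>
         arr s'' ?o (\<lambda>y. (\<exists>c<j. one f c x n y) \<or> one f j x n y))"
        using search_correct[OF e _ _ x(2) 7(3)] 7(2) by blast
      then show ?case
        by (rule runs_mono) (use 7(2) in \<open>simp_all add: ex_less_Suc arr_def\<close>)
    next
      case (8 s')
      then show ?case
        using base_regs_simps(2)[OF env1] by simp
    next
      case 9
      have "n * (500 * n ^ 3 + 14) \<le> 520 * n ^ Suc 3"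
        by (rule loop_time[of _ _ 500 3 0]) (use n_pos in auto)
      then show ?case by (simp add: eval_nat_numeral)
    qed (use base_regs_simps(2)[OF env1] n_pos k_le in simp_all)
    then show ?case
    proof (rule runs_Seq_le[where ?T2.0 = "60 * n"], goal_cases)
      case (1 s2)
      have rg2: "reg s2 r = reg s r"
        if "r \<in> {''n'', ''k'', ''row'', ''rep'', ''rad'', ''dig'', ''ok'', ''base'', ''x'', ''good''}" for r
      proof -
        have "reg s2 r = reg s1 r"
          by (rule framed_reg[OF 1(1)]) (use that in \<open>elim insertE emptyE; simp\<close>)
        with rg[OF that] show ?thesis by simp
      qed
      have "env s2"
        by (rule env_cong[OF env]) (use rg2 1(2) in auto)
      then have "runs verdict s2 (60 * n) (\<lambda>s'. (\<forall>i<?o. mem s' i = mem s2 i) \<and>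
          reg s' ''good'' = (if \<forall>y<n. y \<noteq> x \<longrightarrow> (\<exists>c<k. one f c x n y) then reg s2 ''good'' else 0))"
        by (rule verdict_correct) (use 1(2) x rg2[of "''x''"] in auto)
      then show ?case
        by (rule runs_mono) (use 1(2) rg2[of "''good''"] in \<open>auto simp: good_source_def\<close>)
    qed (use n4 in linarith)
  qed (use n4 in linarith)
qed

lemma check_correct:
  assumes env: "env s" and f: "colored s f"
  shows "runs check s (800 * n ^ 5) (\<lambda>s'. (\<forall>i<q + 5 * n. mem s' i = mem s i) \<and>
     reg s' ''good'' = of_bool (\<forall>x<n. good_source k f x))"
  unfolding check_def
proof (rule runs_Seq_le[where ?Q1.0 = "\<lambda>s'. reg s' ''good'' = 1" and ?T1.0 = 2 and ?T2.0 = "720 * n ^ 5"], goal_cases)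
  case 1
  show ?case by (intro runs_wp) simp_all
next
  case (2 s1)
  have e1: "env s1"
    using env_framed[OF env 2(1)] by simp
  show ?case
  proof (rule runs_For_le[where n = n and B = "700 * n ^ 4" and I = "\<lambda>j s'.
      (\<forall>i<q + 5 * n. mem s' i = mem s i) \<and> reg s' ''good'' = of_bool (\<forall>x<j. good_source k f x)"], goal_cases)
    case 6
    show ?case using 2 framed_mem[OF 2(1)] by simp
  next
    case (7 j s')
    have rg': "reg s' r = reg s1 r"
      if "r \<in> {''n'', ''k'', ''row'', ''rep'', ''rad'', ''dig'', ''ok'', ''base''}" for r
      by (rule framed_reg[OF 7(4)]) (use that in \<open>elim insertE emptyE; simp\<close>)
    have e: "env s'"
      by (rule env_cong[OF e1]) (use rg' 7(2) framed_mem[OF 2(1)] in auto)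
    have c: "colored s' f"
      by (rule colored_cong[OF f]) (use 7(2) in auto)
    have "j < n"
      using 7(1) e1 by (simp add: base_regs_simps)
    from source_correct[OF e c 7(3) this] show ?case
      by (rule runs_mono) (use 7(2) in \<open>simp_all add: all_less_Suc\<close>)
  next
    case 9
    have "n * (700 * n ^ 4 + 14) \<le> 720 * n ^ Suc 4"
      by (rule loop_time[of _ _ 700 4 0]) (use n_pos in auto)
    then show ?case by (simp add: eval_nat_numeral)
  qed (use e1 n_pos in \<open>simp_all add: base_regs_simps\<close>)
qed (use n_pos one_le_power[of n 5] in simp)

end

subsection \<open>Enumeration of colorings\<close>

definition digit :: "(nat \<Rightarrow> nat) \<Rightarrow> nat \<Rightarrow> nat \<Rightarrow> nat" where
  "digit b m v = m div (\<Prod>u<v. b u) mod b v"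

lemma Suc_mod_eq: "0 < b \<Longrightarrow> Suc x mod b = (if x mod b + 1 < b then x mod b + 1 else 0)"
  using Suc_lessI[of "x mod b" b] by (auto simp: mod_Suc)

lemma digit_step:
  fixes b :: "nat \<Rightarrow> nat"
  assumes pos: "\<And>u. u \<le> v \<Longrightarrow> 0 < b u"
  shows digit_Suc: "digit b (Suc m) v = (if (\<Prod>u<v. b u) dvd Suc m
      then if digit b m v + 1 < b v then digit b m v + 1 else 0 else digit b m v)"
    and prod_dvd_Suc: "(\<Prod>u<Suc v. b u) dvd Suc m \<longleftrightarrow> (\<Prod>u<v. b u) dvd Suc m \<and> \<not> digit b m v + 1 < b v"
proof -
  let ?K = "\<Prod>u<v. b u"
  have K: "0 < ?K"
    using pos by (auto intro!: prod_pos)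
  have q: "Suc m div ?K = (if ?K dvd Suc m then Suc (m div ?K) else m div ?K)"
    by (simp add: div_Suc dvd_eq_mod_eq_0)
  have bv: "0 < b v"
    using pos by simp
  show "digit b (Suc m) v = (if ?K dvd Suc m
      then if digit b m v + 1 < b v then digit b m v + 1 else 0 else digit b m v)"
    unfolding digit_def q using Suc_mod_eq[OF bv] by simp
  show "(\<Prod>u<Suc v. b u) dvd Suc m \<longleftrightarrow> ?K dvd Suc m \<and> \<not> digit b m v + 1 < b v"
  proof (cases "?K dvd Suc m")
    case True
    then have "Suc m = ?K * Suc (m div ?K)"
      using q by (metis dvd_mult_div_cancel)
    then have "?K * b v dvd Suc m \<longleftrightarrow> b v dvd Suc (m div ?K)"
      using K by (metis nat_mult_dvd_cancel1)
    also have "\<dots> \<longleftrightarrow> \<not> digit b m v + 1 < b v"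
      unfolding digit_def using Suc_mod_eq[OF bv, of "m div ?K"] by (simp add: dvd_eq_mod_eq_0)
    finally show ?thesis using True by simp
  next
    case False
    then show ?thesis by (auto dest: dvd_mult_left)
  qed
qed

lemma digit_less: "0 < b v \<Longrightarrow> digit b m v < b v"
  by (simp add: digit_def)

lemma digit_0: "digit b 0 v = 0"
  by (simp add: digit_def)

lemma ex_digits:
  fixes b h :: "nat \<Rightarrow> nat"
  assumes "\<And>v. v < r \<Longrightarrow> h v < b v"
  shows "\<exists>m<\<Prod>u<r. b u. \<forall>v<r. digit b m v = h v"
  using assms
proof (induction r)
  case 0
  show ?case by simp
next
  case (Suc r)
  then obtain m where m: "m < (\<Prod>u<r. b u)" "\<forall>v<r. digit b m v = h v"
    by auto
  let ?K = "\<Prod>u<r. b u"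
  let ?m = "m + h r * ?K"
  have "?m < ?K + h r * ?K"
    using m by simp
  also have "\<dots> = Suc (h r) * ?K"
    by simp
  also have "\<dots> \<le> b r * ?K"
    using Suc.prems[of r] by (intro mult_right_mono) auto
  finally have "?m < (\<Prod>u<Suc r. b u)"
    by (simp add: mult.commute)
  moreover have "digit b ?m v = h v" if v: "v < Suc r" for v
  proof (cases "v = r")
    case True
    have "?m div ?K = h r"
      using div_mult_self1[of ?K m "h r"] m(1) by (metis add.right_neutral div_less gr_implies_not0)
    with True show ?thesis
      using Suc.prems[of r] by (simp add: digit_def)
  next
    case False
    with v have "v < r" by simp
    then have "{..<r} = {..<v} \<union> {v} \<union> {Suc v..<r}" by auto
    then have "?K = (\<Prod>u\<in>{..<v} \<union> {v} \<union> {Suc v..<r}. b u)" by (rule arg_cong)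
    also have "\<dots> = (\<Prod>u<v. b u) * b v * (\<Prod>u\<in>{Suc v..<r}. b u)"
      by (subst prod.union_disjoint; (auto simp: prod.union_disjoint mult.commute)?)+
    finally obtain L where K: "?K = (\<Prod>u<v. b u) * (b v * L)" by (metis mult.assoc)
    have "0 < ?K" using m(1) by linarith
    then have "0 < (\<Prod>u<v. b u)" using K by (metis mult_is_0 not_gr0)
    moreover have "?m = m + (\<Prod>u<v. b u) * (b v * L * h r)"
      using K by (simp add: mult.commute mult.left_commute)
    ultimately have "?m div (\<Prod>u<v. b u) = b v * L * h r + m div (\<Prod>u<v. b u)"
      by (metis div_mult_self2 less_not_refl)
    then have "digit b ?m v = digit b m v"
      unfolding digit_def by (simp add: mult.assoc)
    with m \<open>v < r\<close> show ?thesis by simp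
  qed
  ultimately show ?case by blast
qed

definition increment :: com where
  "increment = Seq (Assign ''carry'' (Const 1)) (For ''v'' ''n'' (If1 (nzB (Reg ''carry''))
     (Cond (Less (Add (cell ''dig'' ''v'') (Const 1)) (cell ''rad'' ''v''))
       (Seq (Store (Add (Reg ''dig'') (Reg ''v'')) (Add (cell ''dig'' ''v'') (Const 1)))
            (Assign ''carry'' (Const 0)))
       (Store (Add (Reg ''dig'') (Reg ''v'')) (Const 0)))))"

definition try_coloring :: com where
  "try_coloring = Seq check (Seq (If1 (nzB (Reg ''good'')) (Assign ''out'' (Const 1))) increment)"

definition enumerate_colorings :: com where
  "enumerate_colorings = Seq (Seq (Assign ''carry'' (Const 0)) (Assign ''out'' (Const 0)))
     (While (Less (Reg ''carry'') (Const 1)) try_coloring)"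

lemma writes_increment [simp]: "writes increment = {''carry'', ''v''}"
  by (auto simp: increment_def)

context layout begin

lemma writes_check [simp]:
  "writes check = {''y'', ''u'', ''e'', ''z'', ''o'', ''cur'', ''cur1'', ''cur2'', ''l'', ''c'', ''good'', ''x''}"
  by (auto simp: check_def)

definition digits_at :: "(nat \<Rightarrow> nat) \<Rightarrow> ram \<Rightarrow> nat \<Rightarrow> bool" where
  "digits_at b s m \<longleftrightarrow> (\<forall>v<n. mem s (q + 3 * n + v) = b v) \<and> (\<forall>v<n. mem s (q + 4 * n + v) = digit b m v)"

lemma increment_correct:
  assumes env: "env s" and m: "digits_at b s m" and b: "\<And>v. v < n \<Longrightarrow> 0 < b v"
  shows "runs increment s (70 * n) (\<lambda>s'. (\<forall>i<q + 4 * n. mem s' i = mem s i) \<and>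
    digits_at b s' (Suc m) \<and> reg s' ''carry'' = of_bool ((\<Prod>u<n. b u) dvd Suc m))"
  unfolding increment_def
proof (rule runs_Seq_le[where ?Q1.0 = "\<lambda>s'. reg s' ''carry'' = 1" and ?T1.0 = 2 and ?T2.0 = "65 * n"], goal_cases)
  case 1
  show ?case by (intro runs_wp) simp_all
next
  case (2 s1)
  have mem1: "mem s1 = mem s" and rg: "reg s1 ''n'' = n" "reg s1 ''dig'' = q + 4 * n" "reg s1 ''rad'' = q + 3 * n"
    using framed_mem[OF 2(1)] framed_reg[OF 2(1)] env by (simp_all add: base_regs_simps)
  show ?case
  proof (rule runs_For_le[where n = n and B = 50 and I = "\<lambda>j s'. (\<forall>i<q + 4 * n. mem s' i = mem s i) \<and>
      (\<forall>v<n. mem s' (q + 4 * n + v) = (if v < j then digit b (Suc m) v else digit b m v)) \<and>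
      reg s' ''carry'' = of_bool ((\<Prod>u<j. b u) dvd Suc m)"], goal_cases)
    case 6
    then show ?case
      using 2(2) mem1 m by (simp add: digits_at_def)
  next
    case (7 j s')
    have rg': "reg s' ''dig'' = q + 4 * n" "reg s' ''rad'' = q + 3 * n"
      using framed_reg[OF 7(4)] rg by simp_all
    have j: "j < n"
      using 7(1) rg by simp
    have d: "mem s' (q + 4 * n + j) = digit b m j" "mem s' (q + 3 * n + j) = b j"
      using 7(2) j m by (simp_all add: digits_at_def)
    have S: "digit b (Suc m) j = (if (\<Prod>u<j. b u) dvd Suc m
        then if digit b m j + 1 < b j then digit b m j + 1 else 0 else digit b m j)"
      "(\<Prod>u<Suc j. b u) dvd Suc m \<longleftrightarrow> (\<Prod>u<j. b u) dvd Suc m \<and> \<not> digit b m j + 1 < b j"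
      using b j by (intro digit_Suc prod_dvd_Suc; simp)+
    show ?case
    proof (cases "(\<Prod>u<j. b u) dvd Suc m")
      case True
      then show ?thesis
        using 7(2,3) j rg' d by (intro runs_wp; cases "digit b m j + 1 < b j")
          (simp_all add: S less_Suc_eq del: prod.lessThan_Suc)
    next
      case False
      then show ?thesis
        using 7(2,3) j by (intro runs_wp) (simp_all add: S less_Suc_eq del: prod.lessThan_Suc)
    qed
  next
    case (8 s')
    then show ?case
      using rg m by (simp add: digits_at_def)
  qed (use rg n_pos in simp_all)
qed (use n_pos in simp)

lemma try_coloring_correct:
  assumes env: "env s" and b: "\<And>v. v < n \<Longrightarrow> 0 < b v" and m: "digits_at b s m"
    and rep: "\<And>v. v < n \<Longrightarrow> mem s (q + 2 * n + v) = rep v" "\<And>v. v < n \<Longrightarrow> rep v < n"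
  shows "runs try_coloring s (890 * n ^ 5) (\<lambda>s'. env s' \<and> (\<forall>i<q + 3 * n. mem s' i = mem s i) \<and>
    digits_at b s' (Suc m) \<and> reg s' ''carry'' = of_bool ((\<Prod>u<n. b u) dvd Suc m) \<and>
    reg s' ''out'' = (if \<forall>x<n. good_source k (\<lambda>v. digit b m (rep v)) x then 1 else reg s ''out''))"
proof -
  have n5: "1 \<le> n ^ 5" "n \<le> n ^ 5"
    using n_pos by (auto intro: self_le_power)
  define g where "g \<longleftrightarrow> (\<forall>x<n. good_source k (\<lambda>v. digit b m (rep v)) x)"
  have "colored s (\<lambda>v. digit b m (rep v))"
    using rep m by (simp add: colored_def digits_at_def)
  from check_correct[OF env this] show ?thesis
    unfolding try_coloring_def g_def[symmetric]
  proof (rule runs_Seq_le[where ?T2.0 = "80 * n"], goal_cases)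
    case (1 s1)
    have rg: "reg s1 r = reg s r"
      if "r \<in> {''n'', ''k'', ''row'', ''rep'', ''rad'', ''dig'', ''ok'', ''base'', ''out''}" for r
      by (rule framed_reg[OF 1(1)]) (use that in \<open>elim insertE emptyE; simp\<close>)
    have mem1: "mem s1 i = mem s i" if "i < q + 5 * n" for i
      using 1(2) that by simp
    have env1: "env s1"
      by (rule env_cong[OF env]) (use rg mem1 in auto)
    have d1: "digits_at b s1 m"
      using m mem1 by (simp add: digits_at_def)
    have "reg s1 ''good'' = of_bool g" "reg s1 ''out'' = reg s ''out''"
      using 1(2) rg[of "''out''"] by simp_all
    then have "runs (If1 (nzB (Reg ''good'')) (Assign ''out'' (Const 1))) s1 10
      (\<lambda>s'. reg s' ''out'' = (if g then 1 else reg s ''out''))"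
      by (intro runs_wp) simp_all
    then show ?case
    proof (rule runs_Seq_le[where ?T2.0 = "70 * n"], goal_cases)
      case (1 s2)
      have env2: "env s2"
        using env_framed[OF env1 1(1)] by simp
      have mem2: "mem s2 = mem s1"
        using framed_mem[OF 1(1)] by simp
      have "digits_at b s2 m"
        using d1 mem2 by (simp add: digits_at_def)
      from increment_correct[OF env2 this b] show ?case
      proof (rule runs_mono, goal_cases)
        case (3 s3)
        have rg3: "reg s3 r = reg s2 r"
          if "r \<in> {''n'', ''k'', ''row'', ''rep'', ''rad'', ''dig'', ''ok'', ''base'', ''out''}" for r
          by (rule framed_reg[OF 3(1)]) (use that in \<open>elim insertE emptyE; simp\<close>)
        have mem3: "mem s3 i = mem s2 i" if "i < q + 4 * n" for i
          using 3(2) that by blast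
        have "env s3"
          by (rule env_cong[OF env2]) (use rg3 mem3 in auto)
        moreover have "mem s3 i = mem s i" if "i < q + 3 * n" for i
          using mem3[of i] mem2 mem1 that by simp
        moreover have "reg s3 ''out'' = (if g then 1 else reg s ''out'')"
          using rg3[of "''out''"] 1(2) by simp
        moreover have "digits_at b s3 (Suc m)" "reg s3 ''carry'' = of_bool (prod b {..<n} dvd Suc m)"
          using 3(2) by blast+
        ultimately show ?case
          by (intro conjI allI impI)
      qed auto
    qed (use n_pos in simp)
  qed (use n5 in linarith)
qed

lemma enumerate_correct:
  assumes env: "env s" and b: "\<And>v. v < n \<Longrightarrow> 0 < b v" and m: "digits_at b s 0"
    and rep: "\<And>v. v < n \<Longrightarrow> mem s (q + 2 * n + v) = rep v" "\<And>v. v < n \<Longrightarrow> rep v < n"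
  shows "runs enumerate_colorings s ((\<Prod>u<n. b u) * (1000 * n ^ 5))
    (\<lambda>s'. reg s' ''out'' = of_bool (\<exists>m<\<Prod>u<n. b u. \<forall>x<n. good_source k (\<lambda>v. digit b m (rep v)) x))"
proof -
  let ?M = "\<Prod>u<n. b u"
  define g where "g m \<longleftrightarrow> (\<forall>x<n. good_source k (\<lambda>v. digit b m (rep v)) x)" for m
  define I where "I m s' \<longleftrightarrow> env s' \<and> (\<forall>i<q + 3 * n. mem s' i = mem s i) \<and> digits_at b s' m \<and>
    reg s' ''carry'' = of_bool (0 < m \<and> ?M dvd m) \<and> reg s' ''out'' = of_bool (\<exists>m'<m. g m')" for m s'
  have M: "0 < ?M"
    using b by (auto intro!: prod_pos)
  have n5: "1 \<le> n ^ 5"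
    using n_pos by simp
  show ?thesis
    unfolding g_def[symmetric] enumerate_colorings_def
  proof (rule runs_Seq_le[where ?Q1.0 = "\<lambda>s'. reg s' ''carry'' = 0 \<and> reg s' ''out'' = 0" and ?T1.0 = 4
        and ?T2.0 = "?M * (900 * n ^ 5) + 4"], goal_cases)
    case 1
    show ?case by (intro runs_wp) simp_all
  next
    case (2 s1)
    have mem1: "mem s1 = mem s"
      using framed_mem[OF 2(1)] by simp
    have env1: "env s1"
      using env_framed[OF env 2(1)] by simp
    have "runs (While (Less (Reg ''carry'') (Const 1)) try_coloring) s1
       (?M * (1 + bcost (Less (Reg ''carry'') (Const 1)) + 890 * n ^ 5) + 1 + bcost (Less (Reg ''carry'') (Const 1)))
       (\<lambda>s'. \<not> bval (Less (Reg ''carry'') (Const 1)) s' \<and> (\<exists>m\<le>?M. I m s'))"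
    proof (rule runs_While, goal_cases)
      case 1
      show ?case
        using 2(2) env1 mem1 m by (simp add: digits_at_def I_def)
    next
      case (2 j s')
      then have I: "env s'" "digits_at b s' j" "\<And>i. i < q + 3 * n \<Longrightarrow> mem s' i = mem s i"
          "reg s' ''out'' = of_bool (\<exists>m'<j. g m')"
        by (simp_all add: I_def)
      have "runs try_coloring s' (890 * n ^ 5) (\<lambda>s''. env s'' \<and> (\<forall>i<q + 3 * n. mem s'' i = mem s' i) \<and>
        digits_at b s'' (Suc j) \<and> reg s'' ''carry'' = of_bool (?M dvd Suc j) \<and>
        reg s'' ''out'' = (if g j then 1 else reg s' ''out''))"
        unfolding g_def by (rule try_coloring_correct) (use I rep b in auto)
      then show ?case
        by (rule runs_mono) (use I in \<open>simp_all add: I_def ex_less_Suc\<close>)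
    next
      case (3 s')
      then show ?case using M by (simp add: I_def)
    qed
    then show ?case
    proof (rule runs_mono, goal_cases)
      case 1
      have "?M * (1 + bcost (Less (Reg ''carry'') (Const 1)) + 890 * n ^ 5) \<le> ?M * (900 * n ^ 5)"
        using n5 by (intro mult_left_mono) simp_all
      then show ?case by simp
    next
      case (2 s')
      then obtain j where j: "j \<le> ?M" "I j s'" "reg s' ''carry'' \<noteq> 0"
        by auto
      then have "0 < j" "?M dvd j"
        unfolding I_def by (simp_all split: if_splits)
      with j(1) have "j = ?M"
        by (simp add: dvd_imp_le le_antisym)
      with j(2) show ?case by (simp add: I_def)
    qed
  next
    case 3
    have "4 + (M * (900 * n ^ 5) + 4) \<le> M * (1000 * n ^ 5)" if "0 < M" for M
    proof -
      have "1 * 1 \<le> M * n ^ 5"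
        using that n5 by (intro mult_le_mono) simp_all
      moreover have "M * (900 * n ^ 5) = 900 * (M * n ^ 5)" "M * (1000 * n ^ 5) = 1000 * (M * n ^ 5)"
        by simp_all
      ultimately show ?thesis
        by linarith
    qed
    from this[OF M] show ?case .
  qed
qed

end

subsection \<open>Classes of twins\<close>

definition twin_test :: com where
  "twin_test = Seq (Assign ''t'' (Const 1)) (For ''w'' ''n''
     (If1 (Neg (eqB (adjE ''u'' ''w'') (adjE ''v'' ''w''))) (Assign ''t'' (Const 0))))"

definition count_twins :: com where
  "count_twins = Seq (Seq (Assign ''cnt'' (Const 0)) (Assign ''r'' (Reg ''v''))) (For ''u'' ''v''
     (Seq twin_test (If1 (nzB (Reg ''t'')) (Seq (Assign ''cnt'' (Add (Reg ''cnt'') (Const 1)))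
       (If1 (eqB (Reg ''cnt'') (Add (Reg ''k'') (Const 1))) (Assign ''r'' (Reg ''u'')))))))"

definition classify :: com where
  "classify = Seq count_twins
    (Seq (Store (Add (Reg ''rep'') (Reg ''v'')) (Reg ''r''))
    (Seq (Store (Add (Reg ''dig'') (Reg ''v'')) (Const 0))
         (Cond (Less (Reg ''cnt'') (Add (Reg ''k'') (Const 1)))
           (Store (Add (Reg ''rad'') (Reg ''v'')) (Reg ''k''))
           (Store (Add (Reg ''rad'') (Reg ''v'')) (Const 1)))))"

lemma writes_twin_test [simp]: "writes twin_test = {''t'', ''w''}"
  and store_free_twin_test [simp]: "store_free twin_test"
  and writes_count_twins [simp]: "writes count_twins = {''cnt'', ''r'', ''u'', ''t'', ''w''}"
  and store_free_count_twins [simp]: "store_free count_twins"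
  by (auto simp: twin_test_def count_twins_def)

lemma writes_classify [simp]: "writes classify = {''cnt'', ''r'', ''u'', ''t'', ''w''}"
  by (simp add: classify_def)

context layout begin

lemma twin_test_correct:
  assumes env: "env s" and u: "reg s ''u'' < n" "reg s ''v'' < n"
  shows "runs twin_test s (80 * n) (\<lambda>s'. reg s' ''t'' = of_bool (twin (reg s ''u'') (reg s ''v'')))"
  unfolding twin_test_def
proof (rule runs_Seq_le[where ?Q1.0 = "\<lambda>s'. reg s' ''t'' = 1" and ?T1.0 = 2 and ?T2.0 = "70 * n"], goal_cases)
  case 1
  show ?case by (intro runs_wp) simp_all
next
  case (2 s1)
  have env1: "env s1"
    using env_framed[OF env 2(1)] by simp
  have u1: "reg s1 ''u'' = reg s ''u''" "reg s1 ''v'' = reg s ''v''"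
    using framed_reg[OF 2(1)] by simp_all
  let ?E = "\<lambda>w. A (reg s ''u'') w \<longleftrightarrow> A (reg s ''v'') w"
  show ?case
  proof (rule runs_For_le[where n = n and B = 50 and I = "\<lambda>j s'. reg s' ''t'' = of_bool (\<forall>w<j. ?E w)"], goal_cases)
    case (7 j s')
    have "env s'"
      using env_framed[OF env1 7(4)] by simp
    moreover have "reg s' ''u'' = reg s ''u''" "reg s' ''v'' = reg s ''v''"
      using framed_reg[OF 7(4)] u1 by simp_all
    moreover have "j < n"
      using 7(1) base_regs_simps(1)[OF env1] by simp
    ultimately have "aval (adjE ''u'' ''w'') s' = of_bool (A (reg s ''u'') j)"
      "aval (adjE ''v'' ''w'') s' = of_bool (A (reg s ''v'') j)"
      using u 7(3) by simp_all
    then show ?case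
      using 7(2) by (intro runs_wp; cases "?E j") (simp_all add: all_less_Suc)
  next
    case (8 s')
    then show ?case
      using base_regs_simps(1)[OF env1] by (simp add: twin_def)
  qed (use 2 base_regs_simps(1)[OF env1] n_pos in simp_all)
qed (use n_pos in simp)

lemma count_twins_correct:
  assumes env: "env s" and v: "reg s ''v'' = v" "v < n"
  shows "runs count_twins s (150 * n ^ 2) (\<lambda>s'. reg s' ''cnt'' = rank v \<and> copies k v (reg s' ''r''))"
  unfolding count_twins_def
proof (rule runs_Seq_le[where ?Q1.0 = "\<lambda>s'. reg s' ''cnt'' = 0 \<and> reg s' ''r'' = v" and ?T1.0 = 4
    and ?T2.0 = "140 * n ^ 2"], goal_cases)
  case 1
  show ?case using v by (intro runs_wp) simp_all
next
  case (2 s1)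
  have env1: "env s1"
    using env_framed[OF env 2(1)] by simp
  have v1: "reg s1 ''v'' = v"
    using framed_reg[OF 2(1)] v by simp
  let ?c = "\<lambda>j. card {u. u < j \<and> twin u v}"
  have Suc: "?c (Suc j) = (if twin j v then Suc (?c j) else ?c j)" for j
  proof -
    have "{u. u < Suc j \<and> twin u v} = (if twin j v then insert j {u. u < j \<and> twin u v} else {u. u < j \<and> twin u v})"
      by (auto simp: less_Suc_eq)
    then show ?thesis by simp
  qed
  have rank: "rank u = ?c u" if "twin u v" for u
  proof -
    have "twin w u \<longleftrightarrow> twin w v" for w
      using that twin_sym twin_trans by blast
    then show ?thesis by (simp add: rank_def)
  qed
  let ?r = "\<lambda>j r. if ?c j \<le> k then r = v else r < j \<and> twin r v \<and> rank r = k"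
  show ?case
  proof (rule runs_For_le[where n = n and B = "110 * n" and I = "\<lambda>j s'. reg s' ''cnt'' = ?c j \<and> ?r j (reg s' ''r'')"], goal_cases)
    case (7 j s')
    have env': "env s'"
      using env_framed[OF env1 7(4)] by simp
    have j: "j < n"
      using 7(1) v1 v by simp
    have v': "reg s' ''v'' = v"
      using framed_reg[OF 7(4)] v1 by simp
    have "runs twin_test s' (80 * n) (\<lambda>s''. reg s'' ''t'' = of_bool (twin j v))"
      using twin_test_correct[OF env'] 7(3) v v' j by simp
    then show ?case
    proof (rule runs_Seq_le[where ?T2.0 = "30 * n"], goal_cases)
      case (1 s2)
      have rg2: "reg s2 ''k'' = k" "reg s2 ''u'' = j" "reg s2 ''cnt'' = ?c j" "reg s2 ''r'' = reg s' ''r''"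
        using framed_reg[OF 1(1)] base_regs_simps(2)[OF env'] 7(2,3) by simp_all
      show ?case
      proof (cases "twin j v")
        case True
        then have t: "reg s2 ''t'' = 1"
          using 1(2) by simp
        show ?thesis
        proof (cases "?c j = k")
          case True
          then show ?thesis
            using t rg2 \<open>twin j v\<close> n_pos by (intro runs_wp) (simp_all add: Suc rank)
        next
          case False
          then have "?r (Suc j) (reg s' ''r'')"
            using 7(2) \<open>twin j v\<close> by (auto simp: Suc split: if_splits)
          then show ?thesis
            using False t rg2 \<open>twin j v\<close> n_pos by (intro runs_wp) (simp_all add: Suc)
        qed
      next
        case False
        then have "?r (Suc j) (reg s' ''r'')"
          using 7(2) by (auto simp: Suc split: if_splits)
        then show ?thesis
          using False 1(2) rg2 n_pos by (intro runs_wp) (simp_all add: Suc)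
      qed
    qed simp
  next
    case (8 s')
    moreover have "rank v = ?c v"
      by (simp add: rank_def)
    ultimately show ?case
      using v1 by (simp add: copies_def split: if_splits)
  next
    case 9
    have "n * (110 * n + 14) \<le> 140 * n ^ Suc 1"
      by (rule loop_time[of _ _ 110 1 0]) (use n_pos in auto)
    then show ?case by (simp add: numeral_2_eq_2)
  qed (use 2 v1 v n_pos in simp_all)
qed (use zero_less_power[OF n_pos, of 2] in linarith)

lemma classify_correct:
  assumes env: "env s" and v: "reg s ''v'' = v" "v < n"
  shows "runs classify s (200 * n ^ 2) (\<lambda>s'. \<exists>r. copies k v r \<and> mem s' = (mem s)
     (q + 2 * n + v := r, q + 4 * n + v := 0, q + 3 * n + v := radix k v))"
  unfolding classify_def
proof (rule runs_Seq_le[OF count_twins_correct[OF env v], where ?T2.0 = "30"], goal_cases)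
  case (1 s1)
  have rg: "reg s1 ''rep'' = q + 2 * n" "reg s1 ''rad'' = q + 3 * n" "reg s1 ''dig'' = q + 4 * n"
    "reg s1 ''k'' = k" "reg s1 ''v'' = v"
    using framed_reg[OF 1(1)] base_regs_simps[OF env] v by simp_all
  have "copies k v (reg s1 ''r'')" "mem s1 = mem s" "reg s1 ''cnt'' = rank v"
    using 1(2) framed_mem[OF 1(1)] by simp_all
  then show ?case
    using rg by (intro runs_wp; cases "rank v \<le> k")
      (auto simp: radix_def intro!: exI[of _ "reg s1 ''r''"])
qed (use zero_less_power[OF n_pos, of 2] in linarith)

lemma tables_correct:
  assumes env: "env s"
  shows "runs (For ''v'' ''n'' classify) s (300 * n ^ 3) (\<lambda>s'. env s' \<and> digits_at (radix k) s' 0 \<and>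
     (\<forall>v<n. copies k v (mem s' (q + 2 * n + v))))"
proof (rule runs_For_le[where n = n and B = "200 * n ^ 2" and I = "\<lambda>j s'. (\<forall>i<q + 2 * n. mem s' i = mem s i) \<and>
     (\<forall>v<j. copies k v (mem s' (q + 2 * n + v)) \<and> mem s' (q + 3 * n + v) = radix k v \<and>
        mem s' (q + 4 * n + v) = 0)"], goal_cases)
  case (7 j s')
  have rg: "reg s' r = reg s r"
    if "r \<in> {''n'', ''k'', ''row'', ''rep'', ''rad'', ''dig'', ''ok'', ''base''}" for r
    by (rule framed_reg[OF 7(4)]) (use that in \<open>elim insertE emptyE; simp\<close>)
  have env': "env s'"
    by (rule env_cong[OF env]) (use rg 7(2) in auto)
  have j: "j < n"
    using 7(1) base_regs_simps(1)[OF env] by simp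
  from classify_correct[OF env' 7(3) j] show ?case
  proof (rule runs_mono[OF _ order_refl], elim exE conjE)
    fix s'' r assume r: "copies k j r" and mem: "mem s'' = (mem s')
      (q + 2 * n + j := r, q + 4 * n + j := 0, q + 3 * n + j := radix k j)"
    have "\<And>i. i < q + 2 * n \<Longrightarrow> mem s'' i = mem s' i"
      "\<And>v. v < j \<Longrightarrow> mem s'' (q + 2 * n + v) = mem s' (q + 2 * n + v)"
      "\<And>v. v < j \<Longrightarrow> mem s'' (q + 3 * n + v) = mem s' (q + 3 * n + v)"
      "\<And>v. v < j \<Longrightarrow> mem s'' (q + 4 * n + v) = mem s' (q + 4 * n + v)"
      "mem s'' (q + 2 * n + j) = r" "mem s'' (q + 3 * n + j) = radix k j" "mem s'' (q + 4 * n + j) = 0"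
      using j by (simp_all add: mem)
    then show "(\<forall>i<q + 2 * n. mem (s''\<lparr>reg := (reg s'')(''v'' := Suc j)\<rparr>) i = mem s i) \<and>
     (\<forall>v<Suc j. copies k v (mem (s''\<lparr>reg := (reg s'')(''v'' := Suc j)\<rparr>) (q + 2 * n + v)) \<and>
        mem (s''\<lparr>reg := (reg s'')(''v'' := Suc j)\<rparr>) (q + 3 * n + v) = radix k v \<and>
        mem (s''\<lparr>reg := (reg s'')(''v'' := Suc j)\<rparr>) (q + 4 * n + v) = 0)"
      using 7(2) r by (simp add: all_less_Suc)
  qed
next
  case (8 s')
  have rg: "reg s' r = reg s r"
    if "r \<in> {''n'', ''k'', ''row'', ''rep'', ''rad'', ''dig'', ''ok'', ''base''}" for r
    by (rule framed_reg[OF 8(2)]) (use that in \<open>elim insertE emptyE; simp\<close>)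
  have "env s'"
    by (rule env_cong[OF env]) (use rg 8(1) in auto)
  then show ?case
    using 8(1) base_regs_simps(1)[OF env] by (simp add: digits_at_def digit_0)
next
  case 9
  have "n * (200 * n ^ 2 + 14) \<le> 300 * n ^ Suc 2"
    by (rule loop_time[of _ _ 200 2 0]) (use n_pos in auto)
  then show ?case by (simp add: eval_nat_numeral)
qed (use base_regs_simps(1)[OF env] n_pos in simp_all)

end

subsection \<open>The complete program\<close>

definition read_input :: com where
  "read_input = Seq
     (Seq (Assign ''n'' (Mem (Const 0))) (Seq (Assign ''k'' (Mem (Const 1))) (Assign ''a'' (Const 2))))
    (Seq (For ''i'' ''n'' (Assign ''a'' (Add (Reg ''a'') (Reg ''n''))))
         (For ''i'' ''n'' (Assign ''p'' (Add (Reg ''p'') (cell ''a'' ''i'')))))"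

definition prepare :: com where
  "prepare = Seq
     (Seq (Assign ''row'' (Add (Reg ''a'') (Reg ''n''))) (Seq (Assign ''rep'' (Add (Reg ''row'') (Reg ''n'')))
     (Seq (Assign ''rad'' (Add (Reg ''rep'') (Reg ''n''))) (Seq (Assign ''dig'' (Add (Reg ''rad'') (Reg ''n'')))
     (Seq (Assign ''ok'' (Add (Reg ''dig'') (Reg ''n''))) (Seq (Assign ''base'' (Add (Reg ''ok'') (Reg ''n'')))
          (Assign ''a'' (Const 2))))))))
     (For ''i'' ''n'' (Seq (Store (Add (Reg ''row'') (Reg ''i'')) (Reg ''a''))
       (Assign ''a'' (Add (Reg ''a'') (Reg ''n'')))))"

definition solver :: com where
  "solver = Seq read_input (Cond (Less (Reg ''p'') (Reg ''k'')) (Assign ''out'' (Const 1))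
     (If1 (nzB (Reg ''k'')) (Seq prepare (Seq (For ''v'' ''n'' classify) enumerate_colorings))))"

lemma writes_read_input [simp]: "writes read_input = {''n'', ''k'', ''a'', ''i'', ''p''}"
  and store_free_read_input [simp]: "store_free read_input"
  by (auto simp: read_input_def)

lemma read_input_correct:
  assumes n: "0 < n" "mem s 0 = n" "mem s 1 = k" and p: "reg s ''p'' = 0"
  shows "runs read_input s (70 * n) (\<lambda>s'. reg s' ''n'' = n \<and> reg s' ''k'' = k \<and>
    reg s' ''a'' = 2 + n * n \<and> reg s' ''p'' = (\<Sum>i<n. mem s (2 + n * n + i)))"
  unfolding read_input_def
proof (rule runs_Seq_le[where ?Q1.0 = "\<lambda>s'. reg s' ''n'' = n \<and> reg s' ''k'' = k \<and> reg s' ''a'' = 2"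
    and ?T1.0 = 10 and ?T2.0 = "60 * n"], goal_cases)
  case 1
  show ?case using n by (intro runs_wp) simp_all
next
  case (2 s1)
  have p1: "reg s1 ''p'' = 0" "mem s1 = mem s"
    using framed_reg[OF 2(1)] framed_mem[OF 2(1)] p by simp_all
  have "runs (For ''i'' ''n'' (Assign ''a'' (Add (Reg ''a'') (Reg ''n'')))) s1 (25 * n)
    (\<lambda>s'. reg s' ''a'' = 2 + n * n)"
  proof (rule runs_For_le[where n = n and B = 5 and I = "\<lambda>j s'. reg s' ''a'' = 2 + j * n"], goal_cases)
    case (7 j s')
    have "reg s' ''n'' = n"
      using framed_reg[OF 7(4)] 2(2) by simp
    then show ?case
      using 7(2) by (intro runs_wp) simp_all
  qed (use 2(2) n in simp_all)
  then show ?case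
  proof (rule runs_Seq_le[where ?T2.0 = "25 * n"], goal_cases)
    case (1 s2)
    have rg2: "reg s2 ''n'' = n" "reg s2 ''k'' = k" "reg s2 ''a'' = 2 + n * n" "reg s2 ''p'' = 0" "mem s2 = mem s"
      using framed_reg[OF 1(1)] framed_mem[OF 1(1)] 1(2) 2(2) p1 by simp_all
    show ?case
    proof (rule runs_For_le[where n = n and B = 10 and I = "\<lambda>j s'. reg s' ''p'' = (\<Sum>i<j. mem s (2 + n * n + i))"], goal_cases)
      case (7 j s')
      have "reg s' ''a'' = 2 + n * n" "mem s' = mem s"
        using framed_reg[OF 7(4)] framed_mem[OF 7(4)] rg2 by simp_all
      then show ?case
        using 7(2,3) by (intro runs_wp) simp_all
    next
      case (8 s')
      then show ?case
        using rg2 framed_reg[OF 8(2)] by simp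
    qed (use rg2 n in simp_all)
  qed (use n in simp)
qed (use n in simp)

context layout begin

lemma prepare_correct:
  assumes rg: "reg s ''n'' = n" "reg s ''k'' = k" "reg s ''a'' = q"
    and adj: "\<And>i j. i < n \<Longrightarrow> j < n \<Longrightarrow> mem s (2 + i * n + j) = of_bool (A i j)"
  shows "runs prepare s (70 * n) env"
  unfolding prepare_def
proof (rule runs_Seq_le[where ?Q1.0 = "\<lambda>s'. base_regs s' \<and> reg s' ''a'' = 2" and ?T1.0 = 30
    and ?T2.0 = "40 * n"], goal_cases)
  case 1
  show ?case using rg by (intro runs_wp) (simp_all add: base_regs_def)
next
  case (2 s1)
  have mem1: "mem s1 = mem s"
    using framed_mem[OF 2(1)] by simp
  have n1: "reg s1 ''n'' = n" "reg s1 ''row'' = q + n" "reg s1 ''a'' = 2"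
    using 2(2) by (simp_all add: base_regs_def)
  show ?case
  proof (rule runs_For_le[where n = n and B = 15 and I = "\<lambda>j s'. reg s' ''a'' = 2 + j * n \<and>
      (\<forall>i<q. mem s' i = mem s i) \<and> (\<forall>i<j. mem s' (q + n + i) = 2 + i * n)"], goal_cases)
    case (7 j s')
    have "reg s' ''row'' = q + n" "reg s' ''n'' = n"
      using framed_reg[OF 7(4)] n1 by simp_all
    then show ?case
      using 7(2,3) by (intro runs_wp) (simp_all add: all_less_Suc)
  next
    case (8 s')
    have rg': "reg s' r = reg s1 r"
      if "r \<in> {''n'', ''k'', ''row'', ''rep'', ''rad'', ''dig'', ''ok'', ''base''}" for r
      by (rule framed_reg[OF 8(2)]) (use that in \<open>elim insertE emptyE; simp\<close>)
    have "base_regs s'"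
      using 2(2) unfolding base_regs_def by (simp add: rg')
    moreover have "mem s' (2 + i * n + j) = of_bool (A i j)" if "i < n" "j < n" for i j
      using 8(1) adj[OF that] row_bound[OF that] by simp
    moreover have "mem s' (q + n + i) = 2 + i * n" if "i < n" for i
      using 8(1) n1 that by simp
    ultimately show ?case
      unfolding env_def by blast
  qed (use n1 n_pos mem1 in simp_all)
qed (use n_pos in simp)

lemma solver_correct_search:
  assumes k: "0 < k" and input: "mem s 0 = n" "mem s 1 = k" "reg s ''p'' = 0"
    and p: "k \<le> (\<Sum>i<n. mem s (q + i))"
    and adj: "\<And>i j. i < n \<Longrightarrow> j < n \<Longrightarrow> mem s (2 + i * n + j) = of_bool (A i j)"
  shows "runs solver s ((\<Prod>v<n. radix k v) * (2000 * n ^ 5)) (\<lambda>s'. \<exists>rep. (\<forall>v<n. copies k v (rep v)) \<and>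
    reg s' ''out'' = of_bool (\<exists>m<\<Prod>v<n. radix k v. \<forall>x<n. good_source k (\<lambda>v. digit (radix k) m (rep v)) x))"
    (is "runs _ _ _ ?Q")
proof -
  let ?M = "\<Prod>v<n. radix k v"
  have rad: "0 < radix k v" for v
    using k by (simp add: radix_def)
  have M: "1 \<le> ?M"
    using rad prod_pos[of "{..<n}" "radix k"] by (simp only: Suc_le_eq One_nat_def)
  have n5: "n \<le> n ^ 5" "n ^ 3 \<le> n ^ 5" "1 \<le> n ^ 5"
    using n_pos by (auto intro: self_le_power power_increasing)
  have le: "n ^ 5 \<le> ?M * n ^ 5"
    using mult_right_mono[OF M, of "n ^ 5"] by simp
  have "runs read_input s (70 * n) (\<lambda>s'. reg s' ''n'' = n \<and> reg s' ''k'' = k \<and>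
    reg s' ''a'' = 2 + n * n \<and> reg s' ''p'' = (\<Sum>i<n. mem s (2 + n * n + i)))"
    by (rule read_input_correct) (use n_pos input in auto)
  then show ?thesis
    unfolding solver_def
  proof (rule runs_Seq_le[where ?T2.0 = "500 * n ^ 5 + ?M * (1000 * n ^ 5)"], goal_cases)
    case (1 s1)
    have mem1: "mem s1 = mem s"
      using framed_mem[OF 1(1)] by simp
    have rg1: "reg s1 ''n'' = n" "reg s1 ''k'' = k" "reg s1 ''a'' = q" "k \<le> reg s1 ''p''"
      using 1(2) p by simp_all
    have "runs (Seq prepare (Seq (For ''v'' ''n'' classify) enumerate_colorings)) s1
      (70 * n + (300 * n ^ 3 + ?M * (1000 * n ^ 5))) ?Q"
    proof (rule runs_Seq_use[OF prepare_correct[OF rg1(1-3)]])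
      fix s2 assume "env s2"
      from tables_correct[OF this]
      show "runs (Seq (For ''v'' ''n'' classify) enumerate_colorings) s2 (300 * n ^ 3 + ?M * (1000 * n ^ 5)) ?Q"
      proof (rule runs_Seq_use, goal_cases)
        case (1 s3)
        let ?rep = "\<lambda>v. mem s3 (q + 2 * n + v)"
        have lt: "?rep v < n" if "v < n" for v
          using 1(2) copies_le that le_less_trans by blast
        have "runs enumerate_colorings s3 (?M * (1000 * n ^ 5))
          (\<lambda>s'. reg s' ''out'' = of_bool (\<exists>m<?M. \<forall>x<n. good_source k (\<lambda>v. digit (radix k) m (?rep v)) x))"
          by (rule enumerate_correct) (use 1(2) rad lt in auto)
        then show ?case
          by (rule runs_mono) (use 1(2) in auto)
      qed
    qed (use adj mem1 in simp)
    then have *: "runs (Seq prepare (Seq (For ''v'' ''n'' classify) enumerate_colorings)) s1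
      (450 * n ^ 5 + ?M * (1000 * n ^ 5)) ?Q"
      by (rule runs_time) (use n5 in linarith)
    show ?case
    proof (rule runs_Cond_le[where T' = "480 * n ^ 5 + ?M * (1000 * n ^ 5)"], goal_cases)
      case 2
      show ?case
        by (rule runs_Cond_le[where T' = "450 * n ^ 5 + ?M * (1000 * n ^ 5)"])
          (use * rg1 k n5 in simp_all)
    qed (use rg1 n5 in simp_all)
  next
    case 2
    have "70 * n + (500 * n ^ 5 + 1000 * (?M * n ^ 5)) \<le> 2000 * (?M * n ^ 5)"
      using n5 le by linarith
    then show ?case
      by (metis mult.left_commute)
  qed
qed

end

lemma solver_correct_trivial:
  assumes n: "0 < n" "mem s 0 = n" "mem s 1 = k" and s: "reg s ''p'' = 0" "reg s ''out'' = 0"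
    and k: "(\<Sum>i<n. mem s (2 + n * n + i)) < k \<or> k = 0"
  shows "runs solver s (100 * n) (\<lambda>s'. reg s' ''out'' = of_bool (0 < k))"
  unfolding solver_def
proof (rule runs_Seq_le[OF read_input_correct[OF n s(1)], where ?T2.0 = "20"], goal_cases)
  case (1 s1)
  have s1: "reg s1 ''out'' = 0" "reg s1 ''k'' = k"
    using framed_reg[OF 1(1)] s 1(2) by simp_all
  show ?case
  proof (rule runs_Cond_le[where T' = "10"], goal_cases)
    case 1
    then show ?case using s1 by (intro runs_wp) simp_all
  next
    case 2
    with s1 k \<open>_ \<and> _ \<and> _ \<and> reg s1 ''p'' = _\<close> have "k = 0" by auto
    then show ?case
      using s1
      by (intro runs_Cond_le[where T' = 1] runs_time[OF runs_Skip]) simp_all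
  qed simp
qed (use n in simp)

lemma (in finite_graph) search_complete:
  assumes k: "0 < k" and rep: "\<And>v. v < n \<Longrightarrow> copies k v (rep v)"
  shows "(\<exists>m<\<Prod>v<n. radix k v. \<forall>x<n. good_source k (\<lambda>v. digit (radix k) m (rep v)) x) \<longleftrightarrow>
    (\<exists>f. (\<forall>v<n. f v < k) \<and> (\<forall>x<n. good_source k f x))"
proof
  have free: "radix k (rep v) = k" if "v < n" for v
    using rep[OF that] by (auto simp: copies_def radix_def split: if_splits)
  {
    assume "\<exists>m<\<Prod>v<n. radix k v. \<forall>x<n. good_source k (\<lambda>v. digit (radix k) m (rep v)) x"
    then obtain m where "\<forall>x<n. good_source k (\<lambda>v. digit (radix k) m (rep v)) x" by blast
    moreover have "digit (radix k) m (rep v) < k" if "v < n" for v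
      using digit_less[of "radix k" "rep v" m] free[OF that] k by simp
    ultimately show "\<exists>f. (\<forall>v<n. f v < k) \<and> (\<forall>x<n. good_source k f x)"
      by (intro exI[of _ "\<lambda>v. digit (radix k) m (rep v)"]) simp
  }
  {
    assume "\<exists>f. (\<forall>v<n. f v < k) \<and> (\<forall>x<n. good_source k f x)"
    then obtain f where "\<And>v. v < n \<Longrightarrow> f v < k" "\<And>x. x < n \<Longrightarrow> good_source k f x" by blast
    from canonical_coloring[OF this rep] obtain g where g: "\<And>v. v < n \<Longrightarrow> g v < k"
        "\<And>x. x < n \<Longrightarrow> good_source k g x" "\<And>v. v < n \<Longrightarrow> g (rep v) = g v"
      by blast
    let ?h = "\<lambda>v. if rank v \<le> k then g v else 0"
    have "?h v < radix k v" if "v < n" for v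
      using g(1)[OF that] by (simp add: radix_def)
    then have "\<exists>m<\<Prod>v<n. radix k v. \<forall>v<n. digit (radix k) m v = ?h v"
      by (rule ex_digits)
    then obtain m where m: "m < (\<Prod>v<n. radix k v)" "\<forall>v<n. digit (radix k) m v = ?h v"
      by blast
    have "digit (radix k) m (rep v) = g v" if v: "v < n" for v
    proof -
      have "rep v < n"
        using copies_le[OF rep[OF v]] v by simp
      moreover have "rank (rep v) \<le> k"
        using rep[OF v] by (auto simp: copies_def split: if_splits)
      ultimately show ?thesis
        using m(2) g(3)[OF v] by simp
    qed
    then have "good_source k (\<lambda>v. digit (radix k) m (rep v)) x" if "x < n" for x
      by (subst good_source_cong[OF that, of _ g]) (simp_all add: g(2) that)
    with m(1) show "\<exists>m<\<Prod>v<n. radix k v. \<forall>x<n. good_source k (\<lambda>v. digit (radix k) m (rep v)) x"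
      by blast
  }
qed

subsection \<open>Instances\<close>

lemma nth_concat_map_upt:
  assumes "i < m" "j < n"
  shows "concat (map (\<lambda>i. map (g i) [0..<n]) [0..<m]) ! (i * n + j) = g i j"
  using assms(1)
proof (induction m)
  case (Suc m)
  let ?c = "concat (map (\<lambda>i. map (g i) [0..<n]) [0..<m])"
  have len: "length ?c = m * n"
    by (simp add: length_concat comp_def sum_list_triv)
  show ?case
  proof (cases "i = m")
    case True
    then show ?thesis
      using assms(2) len by (simp add: nth_append)
  next
    case False
    with Suc.prems have "i < m" by simp
    then have "i * n + j < Suc i * n" "Suc i * n \<le> m * n"
      using assms(2) by (simp_all del: mult_Suc add: mult_le_mono1) simp
    then have "i * n + j < m * n" by linarith
    then show ?thesis
      using Suc.IH[OF \<open>i < m\<close>] len by (simp add: nth_append)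
  qed
qed simp

lemma card_Collect_eq_1: "card {x. P x} = 1 \<longleftrightarrow> (\<exists>!x. P x)"
proof
  assume "card {x. P x} = 1"
  then obtain x where "{x. P x} = {x}"
    by (rule card_1_singletonE)
  then have "P y \<longleftrightarrow> y = x" for y
    by blast
  then show "\<exists>!x. P x" by simp
next
  assume "\<exists>!x. P x"
  then obtain x where "P y \<longleftrightarrow> y = x" for y
    by blast
  then show "card {x. P x} = 1" by simp
qed

locale instance_graph =
  fixes G :: "nat pair_pre_digraph" and X :: "nat set" and n :: nat and A :: "nat \<Rightarrow> nat \<Rightarrow> bool"
  assumes pair_graph: "pair_graph G" and pverts: "pverts G = {..<card (pverts G)}"
    and conn: "Digraph_Component.connected (with_proj G)" and cover: "vertex_cover G X"
  defines "n \<equiv> card (pverts G)" and "A \<equiv> \<lambda>u v. (u, v) \<in> parcs G"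
begin

lemma verts: "pverts G = {..<n}"
  using pverts by (simp add: n_def)

sublocale finite_graph n A
proof
  interpret pair_graph G by (rule pair_graph)
  have "pverts G \<noteq> {}"
    using conn by (simp add: connected_def strongly_connected_def mk_symmetric_def)
  then show "0 < n"
    using verts by auto
  fix u v assume "A u v"
  then show "A v u" "u < n"
    using arcs_symmetric in_arcsD1 verts by (auto simp: A_def)
qed

lemma vwalk_iff: "vwalk p (with_proj G) \<and> hd p = x \<and> last p = y \<longleftrightarrow> walk x y p"
proof -
  have "set (vwalk_arcs p) \<subseteq> parcs G \<longleftrightarrow> successively A p"
    by (induction p rule: vwalk_arcs.induct) (auto simp: A_def)
  then show ?thesis
    by (auto simp: vwalk_def walk_def verts)
qed

lemma shortest_path_iff: "shortest_path G x y p \<longleftrightarrow> geodesic x y p"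
proof
  assume p: "shortest_path G x y p"
  have w: "walk x y p"
    using p vwalk_iff by (auto simp: shortest_path_def vpath_def)
  moreover have "length p \<le> length r" if r: "walk x y r" for r
  proof -
    obtain r' where r': "geodesic x y r'" "length r' \<le> length r"
      using geodesic_exists[OF r] by blast
    then have "walk x y r'" by (simp add: geodesic_def)
    then have "vpath r' (with_proj G) \<and> hd r' = x \<and> last r' = y"
      using geodesic_distinct[OF r'(1)] vwalk_iff[of r' x y] by (simp add: vpath_def)
    then have "vwalk_length p \<le> vwalk_length r'"
      using p by (simp add: shortest_path_def)
    moreover have "p \<noteq> []" "r' \<noteq> []"
      using w \<open>walk x y r'\<close> by (auto simp: walk_def)
    ultimately show ?thesis
      using r'(2) by (cases p; cases r') auto
  qed
  ultimately show "geodesic x y p"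
    by (simp add: geodesic_def)
next
  assume p: "geodesic x y p"
  then have "walk x y p" by (simp add: geodesic_def)
  then have "vpath p (with_proj G) \<and> hd p = x \<and> last p = y"
    using geodesic_distinct[OF p] vwalk_iff[of p x y] by (simp add: vpath_def)
  moreover have "vwalk_length p \<le> vwalk_length r" if "vpath r (with_proj G) \<and> hd r = x \<and> last r = y" for r
  proof -
    have "walk x y r"
      using that vwalk_iff by (auto simp: vpath_def)
    then show ?thesis
      using p by (auto simp: geodesic_def)
  qed
  ultimately show "shortest_path G x y p"
    by (simp add: shortest_path_def)
qed

lemma walk_exists:
  assumes "x < n" "y < n"
  shows "\<exists>p. walk x y p"
proof -
  interpret pair_graph G by (rule pair_graph)
  have "parcs (mk_symmetric (with_proj G)) = parcs G"
    using arcs_symmetric by (auto simp: mk_symmetric_def)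
  then have "mk_symmetric (with_proj G) = G"
    by (intro pair_pre_digraph.equality) (auto simp: mk_symmetric_def)
  then have "x \<rightarrow>\<^sup>*\<^bsub>with_proj G\<^esub> y"
    using conn assms verts by (auto simp: connected_def strongly_connected_def)
  then show ?thesis
    unfolding reachable_vwalk_conv vwalk_iff by blast
qed

lemma cover_edge:
  assumes "A u v"
  shows "u \<in> X \<or> v \<in> X"
proof (rule ccontr)
  have "u < n" "v < n"
    using dom[OF assms] dom[OF sym[OF assms]] .
  moreover assume "\<not> (u \<in> X \<or> v \<in> X)"
  ultimately have "(u, v) \<in> arcs (with_proj G \<restriction> (pverts G - X))"
    using assms by (simp add: verts A_def)
  then show False
    using cover unfolding vertex_cover_def by blast
qed

lemma X_subset: "X \<subseteq> {..<n}"
  using cover verts by (simp add: vertex_cover_def)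

lemma conflict_free_iff:
  assumes "geodesic x y p"
  shows "conflict_free k f p \<longleftrightarrow> (\<exists>c\<in>{1..k}. count_list (map f p) c = 1)"
proof -
  have "(\<exists>!v. v \<in> set p \<and> f v = c) \<longleftrightarrow> count_list (map f p) c = 1" for c
    unfolding count_list_map_distinct[OF geodesic_distinct[OF assms]] by (rule card_Collect_eq_1[symmetric])
  then show ?thesis
    by (simp add: conflict_free_def)
qed

lemma svcf_colorable_iff:
  "svcf_colorable G k \<longleftrightarrow> (\<exists>f. (\<forall>v<n. f v < k) \<and> (\<forall>x<n. good_source k f x))"
proof
  assume "svcf_colorable G k"
  then obtain f where f: "f ` {..<n} \<subseteq> {1..k}"
    and paths: "\<And>x y. x < n \<Longrightarrow> y < n \<Longrightarrow> x \<noteq> y \<Longrightarrow> \<exists>p. geodesic x y p \<and> conflict_free k f p"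
    unfolding svcf_colorable_def shortest_path_iff verts by auto
  let ?g = "\<lambda>v. f v - 1"
  have "?g v < k" if "v < n" for v
  proof -
    have "f v \<in> {1..k}" using f that by blast
    then show ?thesis by auto
  qed
  moreover have "good_source k ?g x" if x: "x < n" for x
    unfolding good_source_iff[OF x]
  proof (intro allI impI)
    fix y assume y: "y < n" "y \<noteq> x"
    then obtain p where p: "geodesic x y p" "conflict_free k f p"
      using paths[of x y] x by blast
    then obtain c where c: "c \<in> {1..k}" "count_list (map f p) c = 1"
      using conflict_free_iff by blast
    have "?g v = c - 1 \<longleftrightarrow> f v = c" if "v \<in> set p" for v
    proof -
      have "v < n"
        using p(1) that by (auto simp: geodesic_def walk_def)
      then have "f v \<in> {1..k}"
        using f by blast
      then show ?thesis using c(1) by auto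
    qed
    then have "{v \<in> set p. ?g v = c - 1} = {v \<in> set p. f v = c}" by blast
    then have "count_list (map ?g p) (c - 1) = 1"
      using c(2) geodesic_distinct[OF p(1)] by (simp add: count_list_map_distinct)
    moreover have "c - 1 < k"
      using c(1) by auto
    ultimately show "\<exists>c<k. \<exists>p. geodesic x y p \<and> count_list (map ?g p) c = 1"
      using p(1) by blast
  qed
  ultimately show "\<exists>f. (\<forall>v<n. f v < k) \<and> (\<forall>x<n. good_source k f x)"
    by (intro exI[of _ ?g]) blast
next
  assume "\<exists>f. (\<forall>v<n. f v < k) \<and> (\<forall>x<n. good_source k f x)"
  then obtain f where f: "\<And>v. v < n \<Longrightarrow> f v < k" "\<And>x. x < n \<Longrightarrow> good_source k f x" by blast
  let ?g = "\<lambda>v. Suc (f v)"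
  have "?g ` {..<n} \<subseteq> {1..k}"
    using f(1) by (auto simp: Suc_le_eq)
  moreover have "\<exists>p. geodesic x y p \<and> conflict_free k ?g p" if xy: "x < n" "y < n" "x \<noteq> y" for x y
  proof -
    obtain c p where c: "c < k" "geodesic x y p" "count_list (map f p) c = 1"
      using f(2)[OF xy(1)] xy(2,3) unfolding good_source_iff[OF xy(1)] by blast
    then have "count_list (map ?g p) (Suc c) = 1"
      using geodesic_distinct[OF c(2)] by (simp add: count_list_map_distinct)
    with c have "conflict_free k ?g p"
      unfolding conflict_free_iff[OF c(2)] by (intro bexI[of _ "Suc c"]) auto
    with c show ?thesis by blast
  qed
  ultimately show "svcf_colorable G k"
    unfolding svcf_colorable_def shortest_path_iff verts by (intro exI[of _ ?g]) simp
qed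

lemma svcf_colorable_mono:
  assumes "svcf_colorable G k" "k \<le> k'"
  shows "svcf_colorable G k'"
proof -
  obtain f where f: "\<forall>v<n. f v < k" "\<forall>x<n. good_source k f x"
    using assms(1) unfolding svcf_colorable_iff by blast
  have "good_source k' f x" if "good_source k f x" for x
    using that assms(2) unfolding good_source_def by (meson order_less_le_trans)
  moreover have "\<forall>v<n. f v < k'"
    using f(1) assms(2) order_less_le_trans by blast
  ultimately show ?thesis
    using f(2) unfolding svcf_colorable_iff by (intro exI[of _ f]) simp
qed

lemma svcf_colorable_large: "card X < k \<Longrightarrow> svcf_colorable G k"
  unfolding svcf_colorable_iff using cover_coloring[of X k] X_subset cover_edge walk_exists by blast

lemma svcfc_le_iff: "svcfc G \<le> k \<longleftrightarrow> svcf_colorable G k"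
proof
  have "svcf_colorable G (svcfc G)"
    unfolding svcfc_def by (rule LeastI, rule svcf_colorable_large[of "Suc (card X)"]) simp
  then show "svcfc G \<le> k \<Longrightarrow> svcf_colorable G k"
    by (rule svcf_colorable_mono)
qed (simp add: svcfc_def Least_le)

lemma encode_eq: "encode (G, k, X) =
  n # k # concat (map (\<lambda>i. map (\<lambda>j. of_bool (A i j)) [0..<n]) [0..<n]) @ map (\<lambda>i. of_bool (i \<in> X)) [0..<n]"
  by (simp add: n_def A_def Let_def)

lemma length_encode: "length (encode (G, k, X)) = 2 + n * n + n"
  unfolding encode_eq by (simp add: length_concat comp_def sum_list_triv)

lemma mem_init:
  "mem (init (encode (G, k, X))) 0 = n"
  "mem (init (encode (G, k, X))) 1 = k"
  "i < n \<Longrightarrow> j < n \<Longrightarrow> mem (init (encode (G, k, X))) (2 + i * n + j) = of_bool (A i j)"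
  "i < n \<Longrightarrow> mem (init (encode (G, k, X))) (2 + n * n + i) = of_bool (i \<in> X)"
proof -
  let ?c = "concat (map (\<lambda>i. map (\<lambda>j. of_bool (A i j)) [0..<n]) [0..<n]) :: nat list"
  have len: "length ?c = n * n"
    by (simp add: length_concat comp_def sum_list_triv)
  have mem: "mem (init (encode (G, k, X))) i = encode (G, k, X) ! i" if "i < 2 + n * n + n" for i
    using that by (simp add: init_def length_encode del: encode.simps)
  show "mem (init (encode (G, k, X))) 0 = n" "mem (init (encode (G, k, X))) 1 = k"
    by (simp_all only: mem) (simp_all add: encode_eq del: encode.simps)
  show "mem (init (encode (G, k, X))) (2 + i * n + j) = of_bool (A i j)" if "i < n" "j < n"
  proof -
    have "i * n + j < i * n + n" "Suc i * n \<le> n * n"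
      using that by (auto simp del: mult_Suc)
    then have lt: "i * n + j < n * n" by simp
    then have "mem (init (encode (G, k, X))) (2 + i * n + j) = ?c ! (i * n + j)"
      by (subst mem) (simp_all add: encode_eq nth_append len del: encode.simps)
    then show ?thesis
      using nth_concat_map_upt[OF that, of "\<lambda>i j. of_bool (A i j)"] by simp
  qed
  show "mem (init (encode (G, k, X))) (2 + n * n + i) = of_bool (i \<in> X)" if "i < n"
    using that by (subst mem) (simp_all add: encode_eq nth_append len del: encode.simps)
qed

lemma sum_X: "(\<Sum>i<n. mem (init (encode (G, k, X))) (2 + n * n + i)) = card X"
proof -
  have "(\<Sum>i<n. mem (init (encode (G, k, X))) (2 + n * n + i)) = (\<Sum>i<n. of_bool (i \<in> X))"
    by (intro sum.cong) (simp_all only: mem_init lessThan_iff)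
  also have "\<dots> = card ({..<n} \<inter> X)"
    by (simp add: of_bool_def sum.If_cases)
  also have "{..<n} \<inter> X = X"
    using X_subset by blast
  finally show ?thesis .
qed

lemma prod_radix_le:
  assumes "0 < k" "k \<le> card X"
  shows "(\<Prod>v<n. radix k v) \<le> t_bound (card X)"
proof -
  have "card {v. v < n \<and> rank v \<le> k} \<le> card X + (k + 1) * 2 ^ card X"
    using card_free_vertices[OF X_subset] cover_edge by blast
  also have "\<dots> \<le> card X + (card X + 1) * 2 ^ card X"
    using assms by simp
  finally have "k ^ card {v. v < n \<and> rank v \<le> k} \<le> k ^ (card X + (card X + 1) * 2 ^ card X)"
    using assms by (intro power_increasing) auto
  also have "\<dots> \<le> t_bound (card X)"
    unfolding t_bound_def using assms by (intro power_mono) auto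
  finally show ?thesis
    by (simp add: prod_radix)
qed

lemma solver_decides:
  "decides_within solver (encode (G, k, X)) (svcf_colorable G k) (max 1 (t_bound (card X)) * (2000 * n ^ 5))"
proof -
  let ?s = "init (encode (G, k, X))"
  have s: "reg ?s ''p'' = 0" "reg ?s ''out'' = 0"
    by (simp_all add: init_def)
  have "runs solver ?s (max 1 (t_bound (card X)) * (2000 * n ^ 5))
    (\<lambda>s'. reg s' ''out'' = of_bool (svcf_colorable G k))"
  proof (cases "card X < k \<or> k = 0")
    case True
    have "svcf_colorable G k \<longleftrightarrow> 0 < k"
    proof (cases "k = 0")
      case True
      then show ?thesis
        using n_pos unfolding svcf_colorable_iff by auto
    next
      case False
      then show ?thesis
        using \<open>card X < k \<or> k = 0\<close> svcf_colorable_large by simp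
    qed
    moreover have "runs solver ?s (100 * n) (\<lambda>s'. reg s' ''out'' = of_bool (0 < k))"
      using solver_correct_trivial[OF n_pos mem_init(1,2) s] True sum_X by simp
    moreover have "100 * n \<le> max 1 (t_bound (card X)) * (2000 * n ^ 5)"
    proof -
      have "100 * n \<le> 2000 * n ^ 5"
        using self_le_power[of n 5] n_pos by simp
      also have "1 * (2000 * n ^ 5) \<le> max 1 (t_bound (card X)) * (2000 * n ^ 5)"
        by (rule mult_right_mono) simp_all
      finally show ?thesis by simp
    qed
    ultimately show ?thesis
      by (auto intro: runs_time)
  next
    case False
    then have k: "0 < k" "k \<le> card X" by auto
    have "card X \<le> n"
      using card_mono[OF _ X_subset] by simp
    then interpret layout n A k
      using k by unfold_locales simp
    from solver_correct_search[OF k(1) mem_init(1,2) s(1) _ mem_init(3)] sum_X k(2)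
    have "runs solver ?s ((\<Prod>v<n. radix k v) * (2000 * n ^ 5)) (\<lambda>s'. \<exists>rep. (\<forall>v<n. copies k v (rep v)) \<and>
      reg s' ''out'' = of_bool (\<exists>m<\<Prod>v<n. radix k v. \<forall>x<n. good_source k (\<lambda>v. digit (radix k) m (rep v)) x))"
      by simp
    then show ?thesis
    proof (rule runs_mono)
      show "(\<Prod>v<n. radix k v) * (2000 * n ^ 5) \<le> max 1 (t_bound (card X)) * (2000 * n ^ 5)"
        using prod_radix_le[OF k] by (intro mult_right_mono) auto
    next
      fix s' assume "\<exists>rep. (\<forall>v<n. copies k v (rep v)) \<and> reg s' ''out'' =
        of_bool (\<exists>m<\<Prod>v<n. radix k v. \<forall>x<n. good_source k (\<lambda>v. digit (radix k) m (rep v)) x)"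
      then obtain rep where rep: "\<forall>v<n. copies k v (rep v)" and out: "reg s' ''out'' =
        of_bool (\<exists>m<\<Prod>v<n. radix k v. \<forall>x<n. good_source k (\<lambda>v. digit (radix k) m (rep v)) x)"
        by blast
      show "reg s' ''out'' = of_bool (svcf_colorable G k)"
        unfolding out svcf_colorable_iff by (subst search_complete[OF k(1)]) (use rep in auto)
    qed
  qed
  then show ?thesis
    unfolding decides_within_def computes_within_def runs_def by blast
qed

lemma n_le_input_size: "n \<le> input_size (encode (G, k, X))"
proof -
  have "length xs \<le> input_size xs" for xs
    unfolding input_size_def by (induction xs) auto
  from this[of "encode (G, k, X)"] show ?thesis
    unfolding length_encode by linarith
qed

end

lemma instances_instance_graph: "(G, k, X) \<in> svcfc_instances \<Longrightarrow> instance_graph G X"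
  by (simp add: svcfc_instances_def instance_graph_def)

subsection \<open>A computable bound on the parameter dependence\<close>

definition double :: "string \<Rightarrow> com" where
  "double x = Assign x (Add (Reg x) (Reg x))"

definition tower_bound :: com where
  "tower_bound = Seq (Seq (Assign ''p'' (Mem (Const 0))) (Assign ''e'' (Const 2)))
    (Seq (For ''i'' ''p'' (Seq (double ''e'') (Seq (double ''e'') (Seq (double ''e'') (double ''e'')))))
    (Seq (Assign ''out'' (Const 2000)) (For ''i'' ''e'' (double ''out''))))"

lemma computable_tower: "computable (\<lambda>p. 2000 * 2 ^ (2 * 16 ^ p))"
proof -
  have "runs tower_bound s
      (6 + (reg_p * (16 + 8) + 6 + (2 + (2 * 16 ^ reg_p * (4 + 8) + 6)))) (\<lambda>s'. reg s' ''out'' = 2000 * 2 ^ (2 * 16 ^ reg_p))"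
    if p: "mem s 0 = reg_p" for s reg_p
    unfolding tower_bound_def
  proof (rule runs_Seq_use[where ?Q1.0 = "\<lambda>s'. reg s' ''p'' = reg_p \<and> reg s' ''e'' = 2"], goal_cases)
    case 1
    show ?case using p by (intro runs_wp) simp_all
  next
    case (2 s1)
    show ?case
    proof (rule runs_Seq_use[OF runs_For[where I = "\<lambda>j s'. reg s' ''e'' = 2 * 16 ^ j"]], goal_cases)
      case (6 j s')
      then show ?case by (intro runs_wp) (simp_all add: double_def)
    next
      case (7 s2)
      show ?case
      proof (rule runs_Seq_use[where ?Q1.0 = "\<lambda>s'. reg s' ''out'' = 2000"], goal_cases)
        case 1
        show ?case by (intro runs_wp) simp_all
      next
        case (2 s3)
        have "reg s3 ''e'' = 2 * 16 ^ reg_p"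
          using framed_reg[OF 2(1)] 7(2) by simp
        then show ?case
          by (intro runs_mono[OF runs_For[where I = "\<lambda>j s'. reg s' ''out'' = 2000 * 2 ^ j"]])
            (use 2(2) in \<open>auto simp: double_def intro!: runs_wp\<close>)
      qed
    qed (use 2(2) in \<open>simp_all add: double_def\<close>)
  qed
  from this[of "init [p]" p for p] show ?thesis
    unfolding computable_def computes_within_def runs_def init_def by fastforce
qed

lemma t_bound_le: "max 1 (t_bound p) \<le> 2 ^ (2 * 16 ^ p)"
proof -
  have p: "p \<le> 2 ^ p" "p + 1 \<le> 2 ^ p"
    using less_exp[of p] by linarith+
  have "p * (p + (p + 1) * 2 ^ p) \<le> 2 ^ p * (2 ^ p + 2 ^ p * 2 ^ p)"
    using p by (intro mult_mono add_mono) simp_all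
  also have "\<dots> = 4 ^ p + 8 ^ p"
    by (simp add: algebra_simps flip: power_mult_distrib)
  also have "\<dots> \<le> 16 ^ p + 16 ^ p"
    by (intro add_mono power_mono) simp_all
  finally have e: "p * (p + (p + 1) * 2 ^ p) \<le> 2 * 16 ^ p"
    by simp
  have "t_bound p \<le> (2 ^ p) ^ (p + (p + 1) * 2 ^ p)"
    unfolding t_bound_def using p by (intro power_mono) simp_all
  also have "\<dots> \<le> 2 ^ (2 * 16 ^ p)"
    unfolding power_mult[symmetric] using e by (intro power_increasing) simp_all
  finally show ?thesis by simp
qed

theorem theorem1:
  shows "(\<exists>P C. \<forall>(G, k, X)\<in>svcfc_instances.
            decides_within P (encode (G, k, X)) (svcf_colorable G k)
              (max 1 (t_bound (card X)) * (C * card (pverts G) ^ 5)))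
       \<and> fpt svcfc_instances encode (\<lambda>(G, k, X). card X) (\<lambda>(G, k, X). svcfc G \<le> k)"
proof
  have solver: "decides_within solver (encode (G, k, X)) (svcf_colorable G k)
      (max 1 (t_bound (card X)) * (2000 * card (pverts G) ^ 5))" if "(G, k, X) \<in> svcfc_instances" for G k X
    using instance_graph.solver_decides[OF instances_instance_graph[OF that]] .
  then show "\<exists>P C. \<forall>(G, k, X)\<in>svcfc_instances. decides_within P (encode (G, k, X)) (svcf_colorable G k)
      (max 1 (t_bound (card X)) * (C * card (pverts G) ^ 5))"
    by blast
  have "decides_within solver (encode (G, k, X)) (svcfc G \<le> k)
      (2000 * 2 ^ (2 * 16 ^ card X) * input_size (encode (G, k, X)) ^ 5)" if inst: "(G, k, X) \<in> svcfc_instances" for G k X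
  proof -
    note [simp del] = encode.simps
    have "max 1 (t_bound (card X)) * (2000 * card (pverts G) ^ 5)
        \<le> 2 ^ (2 * 16 ^ card X) * (2000 * input_size (encode (G, k, X)) ^ 5)"
      using t_bound_le instance_graph.n_le_input_size[OF instances_instance_graph[OF inst]]
      by (intro mult_mono power_mono) simp_all
    then show ?thesis
      using solver[OF inst] instance_graph.svcfc_le_iff[OF instances_instance_graph[OF inst]]
      unfolding decides_within_def computes_within_def by (fastforce simp: algebra_simps)
  qed
  then show "fpt svcfc_instances encode (\<lambda>(G, k, X). card X) (\<lambda>(G, k, X). svcfc G \<le> k)"
    unfolding fpt_def
    by (intro exI[of _ solver] exI[of _ "\<lambda>p. 2000 * 2 ^ (2 * 16 ^ p)"] exI[of _ 5] conjI computable_tower)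
      (auto simp del: encode.simps)
qed

end
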